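(* Let $n\in\mathbb{N}$, let $L:[a,b]\times\mathbb{R}^{n+1}\to\mathbb{R}$ and $\phi:[a,b]\times\mathbb{R}\to\mathbb{R}$ be of class $C^1$, and let $x_a,x_a^1,\ldots,x_a^{n-1}\in\mathbb{R}$ be fixed. If $(x,T)$ minimizes on $D$ the functional $$\mathcal{J}(x,T)=\int_a^TL[x]_\gamma^{\alpha,\beta}(t)\,dt+\phi(T,x(T))$$ subject to $x(a)=x_a$ and $x^{(i)}(a)=x_a^i$ for all $i\in\{1,\ldots,n-1\}$ ($T$ and $x(T)$ being free), then $(x,T)$ satisfies the Euler--Lagrange equations $$\partial_2L[x]_\gamma^{\alpha,\beta}(t)+\sum_{i=1}^nD_{\overline{\gamma^i}}^{\beta_i(\cdot,\cdot),\alpha_i(\cdot,\cdot)}\partial_{i+2}L[x]_\gamma^{\alpha,\beta}(t)=0\quad\text{on }[a,T],$$ $$\sum_{i=1}^n\gamma_2^i\left({}_aD_t^{\beta_i(\cdot,\cdot)}\partial_{i+2}L[x]_\gamma^{\alpha,\beta}(t)-{}_TD_t^{\beta_i(\cdot,\cdot)}\partial_{i+2}L[x]_\gamma^{\alpha,\beta}(t)\right)=0\quad\text{on }[T,b],$$ and the following transversality conditions: $$L[x]_\gamma^{\alpha,\beta}(T)+\partial_1\phi(T,x(T))-x'(T)\sum_{i=1}^n\left[\gamma_1^i(-1)^{i-1}\frac{d^{i-1}}{dt^{i-1}}\,{}_tI_T^{i-\alpha_i(\cdot,\cdot)}\partial_{i+2}L[x]_\gamma^{\alpha,\beta}(t)-\gamma_2^i\frac{d^{i-1}}{dt^{i-1}}\,{}_TI_t^{i-\beta_i(\cdot,\cdot)}\partial_{i+2}L[x]_\gamma^{\alpha,\beta}(t)\right]_{t=T}=0,$$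 $$\sum_{i=1}^n\left[\gamma_1^i(-1)^{i-1}\frac{d^{i-1}}{dt^{i-1}}\,{}_tI_T^{i-\alpha_i(\cdot,\cdot)}\partial_{i+2}L[x]_\gamma^{\alpha,\beta}(t)-\gamma_2^i\frac{d^{i-1}}{dt^{i-1}}\,{}_TI_t^{i-\beta_i(\cdot,\cdot)}\partial_{i+2}L[x]_\gamma^{\alpha,\beta}(t)\right]_{t=T}+\partial_2\phi(T,x(T))=0,$$ for all $j=2,\ldots,n-1$, $$\sum_{i=j+1}^n\left[\gamma_1^i(-1)^{i-1-j}\frac{d^{i-1-j}}{dt^{i-1-j}}\,{}_tI_T^{i-\alpha_i(\cdot,\cdot)}\partial_{i+2}L[x]_\gamma^{\alpha,\beta}(t)+\gamma_2^i(-1)^{j+1}\frac{d^{i-1-j}}{dt^{i-1-j}}\,{}_TI_t^{i-\beta_i(\cdot,\cdot)}\partial_{i+2}L[x]_\gamma^{\alpha,\beta}(t)\right]_{t=T}=0,$$ and for all $j=0,\ldots,n-1$, $$\sum_{i=j+1}^n\left[\gamma_2^i(-1)^{j+1}\left[\frac{d^{i-1-j}}{dt^{i-1-j}}\,{}_aI_t^{i-\beta_i(\cdot,\cdot)}\partial_{i+2}L[x]_\gamma^{\alpha,\beta}(t)-\frac{d^{i-1-j}}{dt^{i-1-j}}\,{}_TI_t^{i-\beta_i(\cdot,\cdot)}\partial_{i+2}L[x]_\gamma^{\alpha,\beta}(t)\right]\right]_{t=b}=0.$$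
   Context: Let $a<b$ be reals. For $i\in\{1,\ldots,n\}$ let $\alpha_i,\beta_i:[a,b]^2\to(i-1,i)$ be continuous and $\gamma^i=(\gamma_1^i,\gamma_2^i)\in[0,1]^2$ a vector with components not both zero; $\overline{\gamma^i}=(\gamma_2^i,\gamma_1^i)$. For $c\in[a,b]$ and $\delta\in\{\alpha_i,\beta_i\}$ define $${}_cI_t^{i-\delta(\cdot,\cdot)}f(t)=\int_c^t\frac{(t-\tau)^{i-1-\delta(t,\tau)}}{\Gamma(i-\delta(t,\tau))}f(\tau)\,d\tau,\qquad {}_tI_c^{i-\delta(\cdot,\cdot)}f(t)=\int_t^c\frac{(\tau-t)^{i-1-\delta(\tau,t)}}{\Gamma(i-\delta(\tau,t))}f(\tau)\,d\tau,$$ the Riemann--Liouville derivatives ${}_cD_t^{\delta(\cdot,\cdot)}f=\frac{d^i}{dt^i}\,{}_cI_t^{i-\delta(\cdot,\cdot)}f$ and ${}_tD_c^{\delta(\cdot,\cdot)}f=(-1)^i\frac{d^i}{dt^i}\,{}_tI_c^{i-\delta(\cdot,\cdot)}f$, and the Caputo derivatives ${}_a^CD_t^{\alpha_i(\cdot,\cdot)}x={}_aI_t^{i-\alpha_i(\cdot,\cdot)}x^{(i)}$ and ${}_t^CD_b^{\beta_i(\cdot,\cdot)}x=(-1)^i\,{}_tI_b^{i-\beta_i(\cdot,\cdot)}x^{(i)}$. Combined Caputo derivative: ${}^CD_{\gamma^i}^{\alpha_i(\cdot,\cdot),\beta_i(\cdot,\cdot)}x=\gamma_1^i\,{}_a^CD_t^{\alpha_i(\cdot,\cdot)}x+\gamma_2^i\,{}_t^CD_b^{\beta_i(\cdot,\cdot)}x$.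 Dual derivative: $D_{\overline{\gamma^i}}^{\beta_i(\cdot,\cdot),\alpha_i(\cdot,\cdot)}=\gamma_2^i\,{}_aD_t^{\beta_i(\cdot,\cdot)}+\gamma_1^i\,{}_tD_T^{\alpha_i(\cdot,\cdot)}$. Notation: $[x]_\gamma^{\alpha,\beta}(t)=\left(t,x(t),{}^CD_{\gamma^1}^{\alpha_1(\cdot,\cdot),\beta_1(\cdot,\cdot)}x(t),\ldots,{}^CD_{\gamma^n}^{\alpha_n(\cdot,\cdot),\beta_n(\cdot,\cdot)}x(t)\right)$; $L[x]_\gamma^{\alpha,\beta}(t)$ is $L$ evaluated at this vector; $\partial_i$ is the partial derivative with respect to the $i$th argument. $D$ is the set of $(x,t)\in C^n([a,b])\times[a,b]$ such that ${}^CD_{\gamma^i}^{\alpha_i(\cdot,\cdot),\beta_i(\cdot,\cdot)}x$ exists and is continuous on $[a,b]$ for all $i\in\{1,\ldots,n\}$, endowed with the norm $\|(x,t)\|=\max_{[a,b]}|x|+\max_{[a,b]}\sum_{i=1}^n|{}^CD_{\gamma^i}^{\alpha_i(\cdot,\cdot),\beta_i(\cdot,\cdot)}x|+|t|$.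
   Formalization: The formal theorem assumes a<T<b (at T=b the claim fails, e.g. L=-1, φ=0) and that the Riemann–Liouville derivatives of ∂_{i+2}L[x] with nonzero weight γ exist on the closed intervals where the conclusion uses them, since minimality does not imply this. *)

theory Defs
  imports "HOL-Analysis.Analysis"
begin

text \<open>Iterated derivatives relative to a set; on a nondegenerate compact interval they are
  one-sided at the end points.\<close>

primrec nderiv :: "real set \<Rightarrow> nat \<Rightarrow> (real \<Rightarrow> real) \<Rightarrow> real \<Rightarrow> real" where
  "nderiv S 0 f = f"
| "nderiv S (Suc k) f = (\<lambda>t. vector_derivative (nderiv S k f) (at t within S))"

definition times_differentiable_on :: "nat \<Rightarrow> (real \<Rightarrow> real) \<Rightarrow> real set \<Rightarrow> bool" where
  "times_differentiable_on k f S \<longleftrightarrow> (\<forall>m<k. nderiv S m f differentiable_on S)"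

definition C_on :: "nat \<Rightarrow> real set \<Rightarrow> (real \<Rightarrow> real) set" where
  "C_on k S = {f. times_differentiable_on k f S \<and> continuous_on S (nderiv S k f)}"


text \<open>In the right integral the arguments of the order are swapped, so that a single kernel
  serves for both.  On the diagonal the kernel has the value 0, by the convention for \<open>powr\<close>;
  this does not affect the integrals.\<close>

definition fkernel :: "nat \<Rightarrow> (real \<times> real \<Rightarrow> real) \<Rightarrow> real \<Rightarrow> real \<Rightarrow> real" where
  "fkernel i \<delta> s r = (s - r) powr (real i - 1 - \<delta> (s, r)) / Gamma (real i - \<delta> (s, r))"

definition left_int :: "nat \<Rightarrow> (real \<times> real \<Rightarrow> real) \<Rightarrow> real \<Rightarrow> (real \<Rightarrow> real) \<Rightarrow> real \<Rightarrow> real" where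
  "left_int i \<delta> c f t = integral {c..t} (\<lambda>\<tau>. fkernel i \<delta> t \<tau> * f \<tau>)"

definition right_int :: "nat \<Rightarrow> (real \<times> real \<Rightarrow> real) \<Rightarrow> real \<Rightarrow> (real \<Rightarrow> real) \<Rightarrow> real \<Rightarrow> real" where
  "right_int i \<delta> c f t = integral {t..c} (\<lambda>\<tau>. fkernel i \<delta> \<tau> t * f \<tau>)"


text \<open>Riemann--Liouville derivatives.  The left derivative with base point \<open>c\<close> lives on
  \<open>{c..e}\<close>, the right one with base point \<open>c\<close> on \<open>{e..c}\<close>.\<close>

definition left_RL :: "nat \<Rightarrow> (real \<times> real \<Rightarrow> real) \<Rightarrow> real \<Rightarrow> real \<Rightarrow> (real \<Rightarrow> real) \<Rightarrow> real \<Rightarrow> real" where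
  "left_RL i \<delta> c e f t = nderiv {c..e} i (left_int i \<delta> c f) t"

definition right_RL :: "nat \<Rightarrow> (real \<times> real \<Rightarrow> real) \<Rightarrow> real \<Rightarrow> real \<Rightarrow> (real \<Rightarrow> real) \<Rightarrow> real \<Rightarrow> real" where
  "right_RL i \<delta> c e f t = (-1) ^ i * nderiv {e..c} i (right_int i \<delta> c f) t"

definition left_RL_exists :: "nat \<Rightarrow> (real \<times> real \<Rightarrow> real) \<Rightarrow> real \<Rightarrow> real \<Rightarrow> (real \<Rightarrow> real) \<Rightarrow> bool" where
  "left_RL_exists i \<delta> c e f \<longleftrightarrow> times_differentiable_on i (left_int i \<delta> c f) {c..e}"

definition right_RL_exists :: "nat \<Rightarrow> (real \<times> real \<Rightarrow> real) \<Rightarrow> real \<Rightarrow> real \<Rightarrow> (real \<Rightarrow> real) \<Rightarrow> bool" where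
  "right_RL_exists i \<delta> c e f \<longleftrightarrow> times_differentiable_on i (right_int i \<delta> c f) {e..c}"


definition left_Caputo ::
  "real \<Rightarrow> real \<Rightarrow> nat \<Rightarrow> (real \<times> real \<Rightarrow> real) \<Rightarrow> (real \<Rightarrow> real) \<Rightarrow> real \<Rightarrow> real" where
  "left_Caputo a b i \<delta> x t = left_int i \<delta> a (nderiv {a..b} i x) t"

definition right_Caputo ::
  "real \<Rightarrow> real \<Rightarrow> nat \<Rightarrow> (real \<times> real \<Rightarrow> real) \<Rightarrow> (real \<Rightarrow> real) \<Rightarrow> real \<Rightarrow> real" where
  "right_Caputo a b i \<delta> x t = (-1) ^ i * right_int i \<delta> b (nderiv {a..b} i x) t"

text \<open>In the combined operators \<open>g\<close> is the pair of weights attached to the order \<open>i\<close>,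
  \<open>A\<close> is the left order of the Caputo derivative and \<open>B\<close> the right one.\<close>

definition combined_Caputo ::
  "real \<Rightarrow> real \<Rightarrow> nat \<Rightarrow> (real \<times> real \<Rightarrow> real) \<Rightarrow> (real \<times> real \<Rightarrow> real) \<Rightarrow> real \<times> real
    \<Rightarrow> (real \<Rightarrow> real) \<Rightarrow> real \<Rightarrow> real" where
  "combined_Caputo a b i A B g x t =
     fst g * left_Caputo a b i A x t + snd g * right_Caputo a b i B x t"

definition combined_Caputo_exists ::
  "real \<Rightarrow> real \<Rightarrow> nat \<Rightarrow> (real \<times> real \<Rightarrow> real) \<Rightarrow> (real \<times> real \<Rightarrow> real) \<Rightarrow> (real \<Rightarrow> real) \<Rightarrow> bool" where
  "combined_Caputo_exists a b i A B x \<longleftrightarrow>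
     (\<forall>t\<in>{a..b}. (\<lambda>\<tau>. fkernel i A t \<tau> * nderiv {a..b} i x \<tau>) integrable_on {a..t} \<and>
                 (\<lambda>\<tau>. fkernel i B \<tau> t * nderiv {a..b} i x \<tau>) integrable_on {t..b})"

definition dual_RL ::
  "real \<Rightarrow> real \<Rightarrow> real \<Rightarrow> nat \<Rightarrow> (real \<times> real \<Rightarrow> real) \<Rightarrow> (real \<times> real \<Rightarrow> real) \<Rightarrow> real \<times> real
    \<Rightarrow> (real \<Rightarrow> real) \<Rightarrow> real \<Rightarrow> real" where
  "dual_RL a b T i A B g f t =
     snd g * left_RL i B a b f t + fst g * right_RL i A T a f t"


text \<open>The set \<open>{a..b} \<times> \<real>\<^sup>n\<^sup>+\<^sup>1\<close> is rendered as a set of extensional functions on the index set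
  \<open>{1..n+2}\<close>: argument 1 is the time, argument 2 the state, argument \<open>i + 2\<close> the derivative of
  order index \<open>i\<close>.  The topology on functions is the product topology, which on this set is the
  Euclidean one.\<close>

definition slot :: "real \<Rightarrow> real \<Rightarrow> nat \<Rightarrow> real set" where
  "slot a b k = (if k = 1 then {a..b} else UNIV)"

definition Ldom :: "real \<Rightarrow> real \<Rightarrow> nat \<Rightarrow> (nat \<Rightarrow> real) set" where
  "Ldom a b n = (\<Pi>\<^sub>E k\<in>{1..n+2}. slot a b k)"

definition partial :: "real \<Rightarrow> real \<Rightarrow> nat \<Rightarrow> ((nat \<Rightarrow> real) \<Rightarrow> real) \<Rightarrow> (nat \<Rightarrow> real) \<Rightarrow> real" where
  "partial a b k L u = vector_derivative (\<lambda>s. L (u(k := s))) (at (u k) within slot a b k)"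

definition C1_Lagrangian :: "real \<Rightarrow> real \<Rightarrow> nat \<Rightarrow> ((nat \<Rightarrow> real) \<Rightarrow> real) \<Rightarrow> bool" where
  "C1_Lagrangian a b n L \<longleftrightarrow>
     continuous_on (Ldom a b n) L \<and>
     (\<forall>k\<in>{1..n+2}.
        (\<forall>u\<in>Ldom a b n. (\<lambda>s. L (u(k := s))) differentiable (at (u k) within slot a b k)) \<and>
        continuous_on (Ldom a b n) (partial a b k L))"

definition partial1 :: "real \<Rightarrow> real \<Rightarrow> (real \<Rightarrow> real \<Rightarrow> real) \<Rightarrow> real \<Rightarrow> real \<Rightarrow> real" where
  "partial1 a b \<phi> t y = vector_derivative (\<lambda>s. \<phi> s y) (at t within {a..b})"

definition partial2 :: "(real \<Rightarrow> real \<Rightarrow> real) \<Rightarrow> real \<Rightarrow> real \<Rightarrow> real" where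
  "partial2 \<phi> t y = vector_derivative (\<lambda>s. \<phi> t s) (at y)"

definition C1_terminal :: "real \<Rightarrow> real \<Rightarrow> (real \<Rightarrow> real \<Rightarrow> real) \<Rightarrow> bool" where
  "C1_terminal a b \<phi> \<longleftrightarrow>
     continuous_on ({a..b} \<times> UNIV) (\<lambda>(t, y). \<phi> t y) \<and>
     (\<forall>t\<in>{a..b}. \<forall>y. (\<lambda>s. \<phi> s y) differentiable (at t within {a..b}) \<and>
                     (\<lambda>s. \<phi> t s) differentiable (at y)) \<and>
     continuous_on ({a..b} \<times> UNIV) (\<lambda>(t, y). partial1 a b \<phi> t y) \<and>
     continuous_on ({a..b} \<times> UNIV) (\<lambda>(t, y). partial2 \<phi> t y)"


definition jet ::
  "real \<Rightarrow> real \<Rightarrow> nat \<Rightarrow> (nat \<Rightarrow> real \<times> real \<Rightarrow> real) \<Rightarrow> (nat \<Rightarrow> real \<times> real \<Rightarrow> real)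
    \<Rightarrow> (nat \<Rightarrow> real \<times> real) \<Rightarrow> (real \<Rightarrow> real) \<Rightarrow> real \<Rightarrow> nat \<Rightarrow> real" where
  "jet a b n \<alpha> \<beta> \<gamma> x t =
     (\<lambda>k\<in>{1..n+2}. if k = 1 then t else if k = 2 then x t
        else combined_Caputo a b (k - 2) (\<alpha> (k - 2)) (\<beta> (k - 2)) (\<gamma> (k - 2)) x t)"

text \<open>Elements of \<open>D\<close> are represented by functions on the whole line, of which only the values
  on \<open>{a..b}\<close> matter.  The maxima of the norm are written as suprema (the functions are
  continuous on a compact interval).\<close>

definition Dset ::
  "real \<Rightarrow> real \<Rightarrow> nat \<Rightarrow> (nat \<Rightarrow> real \<times> real \<Rightarrow> real) \<Rightarrow> (nat \<Rightarrow> real \<times> real \<Rightarrow> real)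
    \<Rightarrow> (nat \<Rightarrow> real \<times> real) \<Rightarrow> ((real \<Rightarrow> real) \<times> real) set" where
  "Dset a b n \<alpha> \<beta> \<gamma> =
     {(x, t). x \<in> C_on n {a..b} \<and> t \<in> {a..b} \<and>
        (\<forall>i\<in>{1..n}. combined_Caputo_exists a b i (\<alpha> i) (\<beta> i) x \<and>
           continuous_on {a..b} (combined_Caputo a b i (\<alpha> i) (\<beta> i) (\<gamma> i) x))}"

definition Dnorm ::
  "real \<Rightarrow> real \<Rightarrow> nat \<Rightarrow> (nat \<Rightarrow> real \<times> real \<Rightarrow> real) \<Rightarrow> (nat \<Rightarrow> real \<times> real \<Rightarrow> real)
    \<Rightarrow> (nat \<Rightarrow> real \<times> real) \<Rightarrow> (real \<Rightarrow> real) \<Rightarrow> real \<Rightarrow> real" where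
  "Dnorm a b n \<alpha> \<beta> \<gamma> x t =
     (SUP s\<in>{a..b}. \<bar>x s\<bar>) +
     (SUP s\<in>{a..b}. \<Sum>i=1..n. \<bar>combined_Caputo a b i (\<alpha> i) (\<beta> i) (\<gamma> i) x s\<bar>) + \<bar>t\<bar>"

definition functional_J ::
  "real \<Rightarrow> real \<Rightarrow> nat \<Rightarrow> (nat \<Rightarrow> real \<times> real \<Rightarrow> real) \<Rightarrow> (nat \<Rightarrow> real \<times> real \<Rightarrow> real)
    \<Rightarrow> (nat \<Rightarrow> real \<times> real) \<Rightarrow> ((nat \<Rightarrow> real) \<Rightarrow> real) \<Rightarrow> (real \<Rightarrow> real \<Rightarrow> real)
    \<Rightarrow> (real \<Rightarrow> real) \<Rightarrow> real \<Rightarrow> real" where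
  "functional_J a b n \<alpha> \<beta> \<gamma> L \<phi> x T =
     integral {a..T} (\<lambda>t. L (jet a b n \<alpha> \<beta> \<gamma> x t)) + \<phi> T (x T)"

definition admissible ::
  "real \<Rightarrow> real \<Rightarrow> nat \<Rightarrow> (nat \<Rightarrow> real \<times> real \<Rightarrow> real) \<Rightarrow> (nat \<Rightarrow> real \<times> real \<Rightarrow> real)
    \<Rightarrow> (nat \<Rightarrow> real \<times> real) \<Rightarrow> real \<Rightarrow> (nat \<Rightarrow> real) \<Rightarrow> ((real \<Rightarrow> real) \<times> real) set" where
  "admissible a b n \<alpha> \<beta> \<gamma> xa xad =
     {(x, t) \<in> Dset a b n \<alpha> \<beta> \<gamma>.
        x a = xa \<and> (\<forall>i\<in>{1..n-1}. nderiv {a..b} i x a = xad i)}"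

text \<open>Minimality is local with respect to the norm of \<open>D\<close>; every global minimizer is one.\<close>

definition minimizer ::
  "real \<Rightarrow> real \<Rightarrow> nat \<Rightarrow> (nat \<Rightarrow> real \<times> real \<Rightarrow> real) \<Rightarrow> (nat \<Rightarrow> real \<times> real \<Rightarrow> real)
    \<Rightarrow> (nat \<Rightarrow> real \<times> real) \<Rightarrow> ((nat \<Rightarrow> real) \<Rightarrow> real) \<Rightarrow> (real \<Rightarrow> real \<Rightarrow> real)
    \<Rightarrow> real \<Rightarrow> (nat \<Rightarrow> real) \<Rightarrow> (real \<Rightarrow> real) \<Rightarrow> real \<Rightarrow> bool" where
  "minimizer a b n \<alpha> \<beta> \<gamma> L \<phi> xa xad x T \<longleftrightarrow>
     (x, T) \<in> admissible a b n \<alpha> \<beta> \<gamma> xa xad \<and>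
     (\<exists>\<epsilon>>0. \<forall>(y, S) \<in> admissible a b n \<alpha> \<beta> \<gamma> xa xad.
        Dnorm a b n \<alpha> \<beta> \<gamma> (\<lambda>s. y s - x s) (S - T) < \<epsilon> \<longrightarrow>
        functional_J a b n \<alpha> \<beta> \<gamma> L \<phi> x T \<le> functional_J a b n \<alpha> \<beta> \<gamma> L \<phi> y S)"

definition partial_along ::
  "real \<Rightarrow> real \<Rightarrow> nat \<Rightarrow> (nat \<Rightarrow> real \<times> real \<Rightarrow> real) \<Rightarrow> (nat \<Rightarrow> real \<times> real \<Rightarrow> real)
    \<Rightarrow> (nat \<Rightarrow> real \<times> real) \<Rightarrow> ((nat \<Rightarrow> real) \<Rightarrow> real) \<Rightarrow> (real \<Rightarrow> real) \<Rightarrow> nat \<Rightarrow> real \<Rightarrow> real" where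
  "partial_along a b n \<alpha> \<beta> \<gamma> L x k t = partial a b k L (jet a b n \<alpha> \<beta> \<gamma> x t)"

end

theory Submission
  imports Defs
begin

text \<open>Varying the state and the terminal time separately gives two stationarity conditions.
  The time variation is a chain rule.  For the state variation take
  \<open>h\<^sup>(\<^sup>n\<^sup>) = g\<close> with \<open>g\<close> an arbitrary continuous function and the lower derivatives of \<open>h\<close>
  obtained by integrating from \<open>a\<close>.  Fubini moves the fractional integrals onto the partial
  derivatives of \<open>L\<close>, and integrating only the lower-order terms by parts turns the first
  variation into \<open>\<integral> w g\<close>, where \<open>w\<close> is built from iterated tail integrals; hence \<open>w = 0\<close> on both
  sides of \<open>T\<close>.  Differentiating \<open>w = 0\<close> successively on each side produces the Euler--Lagrange
  equations at the last step, and the values at \<open>b\<close> and the jumps at \<open>T\<close> of the intermediate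
  identities are the transversality conditions.  No \<open>n\<close>-fold integration by parts is needed, so
  that the Riemann--Liouville derivatives need not be integrable.\<close>

section \<open>Iterated derivatives and integrals\<close>

text \<open>The obstacle is that the cost is integrated only up to \<open>T\<close>, while the right
  Caputo derivatives at a time t \<le> T see the curve up to \<open>b\<close>. A variation is
  therefore felt beyond \<open>T\<close>, where its coefficients are differences of the left
  integrals based at \<open>a\<close> and at \<open>T\<close>; hence the equation on
  \<open>{T..b}\<close>. The values at \<open>T\<close> of h and its derivatives are free, so the
  boundary terms produced there cannot be dropped. They are absorbed into integration constants of
  the left-hand tails, chosen so that all boundary terms at \<open>T\<close> cancel; these constants
  reappear as jumps. At \<open>a\<close> the derivatives of h of order below \<open>n\<close>
  vanish, and at \<open>b\<close> the constants are 0, which yields the end conditions. On the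
  analytic side the variable orders leave continuity off the diagonal and a uniform bound of the
  kernel by an integrable power; Fubini and the continuity statements rest on these alone. The time
  variation contains x'(T) times \<open>partial2 \<phi>\<close>, which the state condition turns
  into the sum over the orders.\<close>

lemma DERIV_unique_within_interval:
  fixes f :: "real \<Rightarrow> real"
  assumes "c < e" "t \<in> {c..e}"
    and "(f has_real_derivative D) (at t within {c..e})" "(f has_real_derivative D') (at t within {c..e})"
  shows "D = D'"
  using vector_derivative_within_closed_interval[OF assms(1,2), of f D]
    vector_derivative_within_closed_interval[OF assms(1,2), of f D'] assms(3,4)
  by (simp add: has_real_derivative_iff_has_vector_derivative)

lemma nderiv_has_real_derivative:
  assumes "times_differentiable_on k f S" "m < k" "t \<in> S"
  shows "(nderiv S m f has_real_derivative nderiv S (Suc m) f t) (at t within S)"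
proof -
  have "nderiv S m f differentiable (at t within S)"
    using assms by (auto simp: times_differentiable_on_def differentiable_on_def)
  then show ?thesis
    unfolding has_real_derivative_iff_has_vector_derivative nderiv.simps
    by (simp add: vector_derivative_works)
qed

lemma nderiv_continuous_on:
  assumes "times_differentiable_on k f S" "m < k"
  shows "continuous_on S (nderiv S m f)"
  using assms by (simp add: times_differentiable_on_def differentiable_imp_continuous_on)

lemma nderiv_chain_le:
  fixes F :: "nat \<Rightarrow> real \<Rightarrow> real"
  assumes "c < e" and f: "\<And>t. t \<in> {c..e} \<Longrightarrow> f t = F 0 t"
    and F: "\<And>m t. m < k \<Longrightarrow> t \<in> {c..e} \<Longrightarrow> (F m has_real_derivative F (Suc m) t) (at t within {c..e})"
    and "m \<le> k" "t \<in> {c..e}"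
  shows "nderiv {c..e} m f t = F m t"
  using assms(4,5)
proof (induction m arbitrary: t)
  case 0
  then show ?case using f by simp
next
  case (Suc m)
  have "(F m has_real_derivative F (Suc m) t) (at t within {c..e})"
    using F Suc.prems by simp
  then have "(nderiv {c..e} m f has_real_derivative F (Suc m) t) (at t within {c..e})"
    by (rule has_field_derivative_transform_within[OF _ zero_less_one]) (use Suc in auto)
  then have "(nderiv {c..e} m f has_vector_derivative F (Suc m) t) (at t within {c..e})"
    by (simp add: has_real_derivative_iff_has_vector_derivative)
  then show ?case
    using vector_derivative_within_closed_interval[OF \<open>c < e\<close> Suc.prems(2)] by simp
qed

lemma nderiv_chain_differentiable:
  fixes F :: "nat \<Rightarrow> real \<Rightarrow> real"
  assumes "c < e" and f: "\<And>t. t \<in> {c..e} \<Longrightarrow> f t = F 0 t"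
    and F: "\<And>m t. m < k \<Longrightarrow> t \<in> {c..e} \<Longrightarrow> (F m has_real_derivative F (Suc m) t) (at t within {c..e})"
  shows "times_differentiable_on k f {c..e}"
  unfolding times_differentiable_on_def differentiable_on_def
proof (intro allI impI ballI)
  fix m t assume "m < k" "t \<in> {c..e}"
  have "(nderiv {c..e} m f has_real_derivative F (Suc m) t) (at t within {c..e})"
    by (rule has_field_derivative_transform_within[OF F[OF \<open>m < k\<close> \<open>t \<in> {c..e}\<close>] zero_less_one])
      (use nderiv_chain_le[OF assms] \<open>m < k\<close> \<open>t \<in> {c..e}\<close> in auto)
  then show "nderiv {c..e} m f differentiable at t within {c..e}"
    by (metis field_differentiable_def field_differentiable_imp_differentiable)
qed

text \<open>A function with coefficient 0 need not be differentiable; the weights \<open>\<gamma>\<close> may vanish.\<close>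

lemma nderiv_lincomb_aux:
  assumes f: "p \<noteq> 0 \<Longrightarrow> times_differentiable_on k f S"
    and g: "q \<noteq> 0 \<Longrightarrow> times_differentiable_on k g S"
    and "m < k" "t \<in> S"
  shows "((\<lambda>t. p * nderiv S m f t + q * nderiv S m g t) has_real_derivative
          p * nderiv S (Suc m) f t + q * nderiv S (Suc m) g t) (at t within S)"
proof (rule DERIV_add)
  show "((\<lambda>t. p * nderiv S m f t) has_real_derivative p * nderiv S (Suc m) f t) (at t within S)"
    using f[THEN nderiv_has_real_derivative] assms(3,4)
    by (cases "p = 0") (auto intro!: DERIV_cmult simp del: nderiv.simps)
  show "((\<lambda>t. q * nderiv S m g t) has_real_derivative q * nderiv S (Suc m) g t) (at t within S)"
    using g[THEN nderiv_has_real_derivative] assms(3,4)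
    by (cases "q = 0") (auto intro!: DERIV_cmult simp del: nderiv.simps)
qed

lemma nderiv_lincomb:
  assumes "c < e"
    and "p \<noteq> 0 \<Longrightarrow> times_differentiable_on k f {c..e}"
    and "q \<noteq> 0 \<Longrightarrow> times_differentiable_on k g {c..e}"
    and "m \<le> k" "t \<in> {c..e}"
  shows "nderiv {c..e} m (\<lambda>t. p * f t + q * g t) t
           = p * nderiv {c..e} m f t + q * nderiv {c..e} m g t"
  by (rule nderiv_chain_le[where k = k]) (use assms nderiv_lincomb_aux[OF assms(2,3)] in auto)

lemma times_differentiable_lincomb:
  assumes "c < e"
    and "p \<noteq> 0 \<Longrightarrow> times_differentiable_on k f {c..e}"
    and "q \<noteq> 0 \<Longrightarrow> times_differentiable_on k g {c..e}"
  shows "times_differentiable_on k (\<lambda>t. p * f t + q * g t) {c..e}"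
  by (rule nderiv_chain_differentiable
        [where F = "\<lambda>m t. p * nderiv {c..e} m f t + q * nderiv {c..e} m g t"])
    (use assms nderiv_lincomb_aux[OF assms(2,3)] in auto)

text \<open>A derivative within a set restricts to a smaller set, and nondegeneracy keeps it unique.
  This is needed because the left integral based at \<open>a\<close> is differentiated on
  \<open>{a..b}\<close>, while the conditions live on \<open>{a..T}\<close> and
  \<open>{T..b}\<close>.\<close>

lemma nderiv_subinterval:
  assumes "times_differentiable_on k f {c'..e'}" "{c..e} \<subseteq> {c'..e'}" "c < e" "m \<le> k" "t \<in> {c..e}"
  shows "nderiv {c..e} m f t = nderiv {c'..e'} m f t"
  by (rule nderiv_chain_le[where k = k])
    (use assms in \<open>auto intro!: DERIV_subset[OF nderiv_has_real_derivative] simp del: nderiv.simps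
       simp: nderiv.simps(1)\<close>)

lemma times_differentiable_subinterval:
  assumes "times_differentiable_on k f {c'..e'}" "{c..e} \<subseteq> {c'..e'}" "c < e"
  shows "times_differentiable_on k f {c..e}"
  by (rule nderiv_chain_differentiable[where F = "\<lambda>m. nderiv {c'..e'} m f"])
    (use assms in \<open>auto intro!: DERIV_subset[OF nderiv_has_real_derivative] simp del: nderiv.simps
       simp: nderiv.simps(1)\<close>)

section \<open>Iterated integrals as variations of class C^n\<close>

primrec iterated_integral :: "real \<Rightarrow> (real \<Rightarrow> real) \<Rightarrow> nat \<Rightarrow> real \<Rightarrow> real" where
  "iterated_integral a g 0 = g"
| "iterated_integral a g (Suc k) = (\<lambda>t. integral {a..t} (iterated_integral a g k))"

lemma iterated_integral_continuous:
  assumes "continuous_on {a..b} g"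
  shows "continuous_on {a..b} (iterated_integral a g k)"
  by (induction k) (use assms in \<open>auto intro!: indefinite_integral_continuous_1 integrable_continuous_real\<close>)

lemma iterated_integral_deriv:
  assumes "continuous_on {a..b} g" "t \<in> {a..b}"
  shows "(iterated_integral a g (Suc k) has_real_derivative iterated_integral a g k t) (at t within {a..b})"
  using integral_has_real_derivative[OF iterated_integral_continuous[OF assms(1)] assms(2)] by simp

lemma iterated_integral_chain:
  assumes "continuous_on {a..b} g" "t \<in> {a..b}" "m < k"
  shows "(iterated_integral a g (k - m) has_real_derivative iterated_integral a g (k - Suc m) t)
           (at t within {a..b})"
  using iterated_integral_deriv[OF assms(1,2), of "k - Suc m"] assms(3)
  by (simp add: Suc_diff_Suc del: iterated_integral.simps)

text \<open>For \<open>m\<close> below \<open>k\<close> the derivative is again an integral from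
  \<open>a\<close>, hence 0 at \<open>a\<close>: such functions can be added to a curve without
  disturbing its initial data.\<close>

lemma nderiv_iterated_integral:
  assumes "a < b" "continuous_on {a..b} g" "m \<le> k" "t \<in> {a..b}"
  shows "nderiv {a..b} m (iterated_integral a g k) t = iterated_integral a g (k - m) t"
  by (rule nderiv_chain_le[where F = "\<lambda>m. iterated_integral a g (k - m)" and k = k])
    (use assms iterated_integral_chain in auto)

lemma iterated_integral_C_on:
  assumes "a < b" "continuous_on {a..b} g"
  shows "iterated_integral a g k \<in> C_on k {a..b}"
proof -
  have "continuous_on {a..b} (nderiv {a..b} k (iterated_integral a g k))"
    by (rule continuous_on_eq[OF assms(2)]) (simp add: nderiv_iterated_integral[OF assms])
  moreover have "times_differentiable_on k (iterated_integral a g k) {a..b}"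
    by (rule nderiv_chain_differentiable[where F = "\<lambda>m. iterated_integral a g (k - m)"])
      (use assms iterated_integral_chain in auto)
  ultimately show ?thesis by (simp add: C_on_def)
qed

lemma C_on_nderiv_continuous:
  assumes "f \<in> C_on k S" "m \<le> k"
  shows "continuous_on S (nderiv S m f)"
  using assms nderiv_continuous_on[of k f S m] by (cases "m = k") (auto simp: C_on_def)

lemma nderiv_C_on_lincomb:
  assumes "a < b" "x \<in> C_on n {a..b}" "h \<in> C_on n {a..b}" "m \<le> n" "t \<in> {a..b}"
  shows "nderiv {a..b} m (\<lambda>s. x s + \<epsilon> * h s) t = nderiv {a..b} m x t + \<epsilon> * nderiv {a..b} m h t"
  using nderiv_lincomb[of a b 1 n x \<epsilon> h m t] assms by (simp add: C_on_def)

lemma C_on_lincomb: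
  assumes "a < b" "x \<in> C_on n {a..b}" "h \<in> C_on n {a..b}"
  shows "(\<lambda>s. x s + \<epsilon> * h s) \<in> C_on n {a..b}"
proof -
  have "continuous_on {a..b} (nderiv {a..b} n (\<lambda>s. x s + \<epsilon> * h s))"
  proof (rule continuous_on_eq)
    show "continuous_on {a..b} (\<lambda>t. nderiv {a..b} n x t + \<epsilon> * nderiv {a..b} n h t)"
      using assms by (intro continuous_intros C_on_nderiv_continuous[OF _ order_refl])
  qed (simp add: nderiv_C_on_lincomb[OF assms order_refl])
  then show ?thesis
    using times_differentiable_lincomb[of a b 1 n x \<epsilon> h] assms by (auto simp: C_on_def)
qed

section \<open>Weakly singular kernels\<close>

text \<open>What is kept of the fractional kernel: continuity for r < s and a bound by a power of s
  - r with one exponent greater than -1, although the order varies. The diagonal value 0 lets the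
  kernel and its zero extension agree on the closed triangle.\<close>

locale weakly_singular =
  fixes a b C \<mu> :: real and k :: "real \<Rightarrow> real \<Rightarrow> real"
  assumes ab: "a \<le> b" and \<mu>: "0 < \<mu>"
    and k_cont: "continuous_on {(s, r). a \<le> r \<and> r < s \<and> s \<le> b} (\<lambda>(s, r). k s r)"
    and k_diag: "\<And>s. k s s = 0"
    and k_bound: "\<And>s r. a \<le> r \<Longrightarrow> r < s \<Longrightarrow> s \<le> b \<Longrightarrow> \<bar>k s r\<bar> \<le> C * (s - r) powr (\<mu> - 1)"
begin

text \<open>Extending by zero to the plane turns integrals with moving end points into Lebesgue
  integrals over the line.\<close>

definition K :: "real \<Rightarrow> real \<Rightarrow> real" where
  "K s r = (if a \<le> r \<and> r < s \<and> s \<le> b then k s r else 0)"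

text \<open>The majorant is a function of s - r only, so invariance of Lebesgue measure under
  translation and reflection gives it the same finite integral along every line.\<close>

definition maj :: "real \<Rightarrow> real" where
  "maj x = indicator {0<..b - a} x * (C * x powr (\<mu> - 1))"

lemma maj_nonneg: "0 \<le> maj x"
proof (cases "x \<in> {0<..b - a}")
  case True
  \<comment> \<open>The sign of \<open>C\<close> is read off from the bound at s = a + x, r =
    a.\<close>
  then show ?thesis using k_bound[of a "a + x"] by (auto simp: maj_def)
qed (simp add: maj_def)

lemma K_bound: "\<bar>K s r\<bar> \<le> maj (s - r)"
proof (cases "a \<le> r \<and> r < s \<and> s \<le> b")
  case True
  then show ?thesis using k_bound[of r s] by (simp add: K_def maj_def)
next
  case False
  then have "K s r = 0" by (auto simp: K_def)
  then show ?thesis using maj_nonneg by simp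
qed

lemma maj_integrable: "integrable lborel maj"
proof -
  have "(\<lambda>x. x powr (\<mu> - 1)) absolutely_integrable_on {0<..b - a}"
    using \<mu> ab by (intro nonnegative_absolutely_integrable_1 integrable_on_powr_from_0') auto
  then have "set_integrable lborel {0<..b - a} (\<lambda>x. x powr (\<mu> - 1))"
    by (auto simp: set_integrable_def intro!: integrable_completion[THEN iffD1])
  then have "integrable lborel (\<lambda>x. C * (indicator {0<..b - a} x *\<^sub>R x powr (\<mu> - 1)))"
    unfolding set_integrable_def by (rule integrable_mult_right)
  then show ?thesis
    by (rule Bochner_Integration.integrable_cong[THEN iffD1, rotated -1]) (auto simp: maj_def)
qed

lemma K_measurable: "(\<lambda>(s, r). K s r) \<in> borel_measurable (borel \<Otimes>\<^sub>M borel)"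
proof -
  let ?S = "{(s, r). a \<le> r \<and> r < s \<and> s \<le> b}"
  have "?S = {z. a \<le> snd z} \<inter> {z. snd z < fst z} \<inter> {z. fst z \<le> b}" by auto
  moreover have "\<dots> \<in> sets borel"
    by (intro sets.Int borel_closed borel_open closed_Collect_le open_Collect_less continuous_intros)
  ultimately have "(\<lambda>z. indicator ?S z *\<^sub>R (\<lambda>(s, r). k s r) z) \<in> borel_measurable borel"
    by (intro borel_measurable_continuous_on_indicator k_cont) simp
  then show ?thesis
    unfolding borel_prod by (rule measurable_cong[THEN iffD1, rotated]) (auto simp: K_def)
qed

lemma K_measurable_fst: "(\<lambda>s. K s r) \<in> borel_measurable borel"
proof -
  have "(\<lambda>s. (s, r)) \<in> borel \<rightarrow>\<^sub>M borel \<Otimes>\<^sub>M borel" by simp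
  from measurable_compose[OF this K_measurable] show ?thesis by simp
qed

lemma K_measurable_snd: "(\<lambda>r. K s r) \<in> borel_measurable borel"
proof -
  have "(\<lambda>r. (s, r)) \<in> borel \<rightarrow>\<^sub>M borel \<Otimes>\<^sub>M borel" by simp
  from measurable_compose[OF this K_measurable] show ?thesis by simp
qed

lemma K_integrable:
  assumes V: "V \<in> borel_measurable borel" and M: "\<And>r. \<bar>V r\<bar> \<le> M"
  shows K_integrable_snd: "integrable lborel (\<lambda>r. K s r * V r)"
    and K_integrable_fst: "integrable lborel (\<lambda>r. K r s * V r)"
proof -
  have bound: "norm (K s' r' * V q) \<le> norm (maj (s' - r') * M)" for s' r' q
    using mult_mono[OF K_bound[of s' r'] M[of q]] order_trans[OF abs_ge_zero M[of q]] maj_nonneg[of "s' - r'"]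
    by (simp add: abs_mult)
  have "integrable lborel (\<lambda>r. maj (s + (-1) * r))"
    by (intro lborel_integrable_real_affine maj_integrable) simp
  then have "integrable lborel (\<lambda>r. maj (s - r) * M)" by (intro integrable_mult_left) simp
  then show "integrable lborel (\<lambda>r. K s r * V r)"
    by (rule Bochner_Integration.integrable_bound)
      (use V K_measurable_snd in \<open>simp, intro AE_I2 bound\<close>)
  have "integrable lborel (\<lambda>r. maj ((- s) + 1 * r))"
    by (intro lborel_integrable_real_affine maj_integrable) simp
  then have "integrable lborel (\<lambda>r. maj (r - s) * M)" by (intro integrable_mult_left) simp
  then show "integrable lborel (\<lambda>r. K r s * V r)"
    by (rule Bochner_Integration.integrable_bound)
      (use V K_measurable_fst in \<open>simp, intro AE_I2 bound\<close>)
qed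

lemma left_has_integral:
  assumes V: "V \<in> borel_measurable borel" "\<And>r. \<bar>V r\<bar> \<le> M" and t: "t \<in> {a..b}"
  shows "((\<lambda>r. k t r * V r) has_integral (\<integral>r. K t r * V r \<partial>lborel)) {a..t}"
proof -
  have "((\<lambda>r. K t r * V r) has_integral (\<integral>r. K t r * V r \<partial>lborel)) UNIV"
    by (rule has_integral_integral_lborel[OF K_integrable_snd[OF V]])
  then have "((\<lambda>r. if r \<in> {a..t} then k t r * V r else 0) has_integral (\<integral>r. K t r * V r \<partial>lborel)) UNIV"
    by (rule has_integral_eq[rotated]) (use t k_diag in \<open>auto simp: K_def\<close>)
  then show ?thesis by (simp only: has_integral_restrict_UNIV)
qed

lemma right_has_integral:
  assumes V: "V \<in> borel_measurable borel" "\<And>r. \<bar>V r\<bar> \<le> M" and t: "t \<in> {a..b}"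
  shows "((\<lambda>r. k r t * V r) has_integral (\<integral>r. K r t * V r \<partial>lborel)) {t..b}"
proof -
  have "((\<lambda>r. K r t * V r) has_integral (\<integral>r. K r t * V r \<partial>lborel)) UNIV"
    by (rule has_integral_integral_lborel[OF K_integrable_fst[OF V]])
  then have "((\<lambda>r. if r \<in> {t..b} then k r t * V r else 0) has_integral (\<integral>r. K r t * V r \<partial>lborel)) UNIV"
    by (rule has_integral_eq[rotated]) (use t k_diag in \<open>auto simp: K_def\<close>)
  then show ?thesis by (simp only: has_integral_restrict_UNIV)
qed

text \<open>Fubini on the triangle, with the majorant M N maj(s - r) on the strip over
  \<open>{a..b}\<close>. \<open>U\<close> and \<open>V\<close> are bounded and measurable instead of
  continuous because a factor cut off at \<open>T\<close> is inserted later; the integrability of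
  the first integrand allows the outer integral to be split there.\<close>

lemma integral_swap:
  assumes U: "U \<in> borel_measurable borel" "\<And>r. \<bar>U r\<bar> \<le> M"
    and V: "V \<in> borel_measurable borel" "\<And>r. \<bar>V r\<bar> \<le> N"
  shows "integral {a..b} (\<lambda>t. U t * integral {a..t} (\<lambda>r. k t r * V r))
       = integral {a..b} (\<lambda>t. V t * integral {t..b} (\<lambda>r. k r t * U r))"
    and "(\<lambda>t. U t * integral {a..t} (\<lambda>r. k t r * V r)) integrable_on {a..b}"
    and "(\<lambda>t. V t * integral {t..b} (\<lambda>r. k r t * U r)) integrable_on {a..b}"
proof -
  define F where "F = (\<lambda>(s, r). U s * (K s r * V r))"
  define D where "D = (\<lambda>(s, r). indicator {a..b} s * maj (s - r) * (M * N))"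
  have [measurable]: "maj \<in> borel_measurable borel"
    using borel_measurable_integrable[OF maj_integrable] by simp
  note [measurable] = U(1) V(1)
  have K'[measurable]: "(\<lambda>z. K (fst z) (snd z)) \<in> borel_measurable (borel \<Otimes>\<^sub>M borel)"
    using K_measurable by (simp add: case_prod_beta')
  have MN: "0 \<le> M" "0 \<le> N" using U(2)[of 0] V(2)[of 0] by auto
  have maj_shift: "integrable lborel (\<lambda>r. maj (s - r))"
    "(\<integral>r. maj (s - r) \<partial>lborel) = integral\<^sup>L lborel maj" for s
    using lborel_integrable_real_affine[OF maj_integrable, of "-1" s]
      lborel_integral_real_affine[of "-1" maj s] by auto
  have "integrable (lborel \<Otimes>\<^sub>M lborel) D"
  proof (rule lborel_pair.Fubini_integrable)
    show "D \<in> borel_measurable (lborel \<Otimes>\<^sub>M lborel)"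
      unfolding D_def by measurable
    have "(\<integral>r. norm (D (s, r)) \<partial>lborel) = indicator {a..b} s * (integral\<^sup>L lborel maj * (M * N))" for s
    proof -
      have "(\<integral>r. norm (D (s, r)) \<partial>lborel) = (\<integral>r. indicator {a..b} s * (maj (s - r) * (M * N)) \<partial>lborel)"
        using MN maj_nonneg by (intro Bochner_Integration.integral_cong) (auto simp: D_def abs_mult)
      then show ?thesis using maj_shift[of s] by simp
    qed
    moreover have "integrable lborel (\<lambda>s. indicator {a..b} s * (integral\<^sup>L lborel maj * (M * N)))"
      by (intro integrable_mult_left) (simp add: ab)
    ultimately show "integrable lborel (\<lambda>s. \<integral>r. norm (D (s, r)) \<partial>lborel)" by simp
    show "AE s in lborel. integrable lborel (\<lambda>r. D (s, r))"
      using maj_shift by (auto simp: D_def)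
  qed
  then have F: "integrable (lborel \<Otimes>\<^sub>M lborel) F"
  proof (rule Bochner_Integration.integrable_bound)
    show "F \<in> borel_measurable (lborel \<Otimes>\<^sub>M lborel)"
      unfolding F_def case_prod_beta' by measurable
    have "norm (F (s, r)) \<le> norm (D (s, r))" for s r
    proof (cases "s \<in> {a..b}")
      case True
      have "\<bar>U s\<bar> * (\<bar>K s r\<bar> * \<bar>V r\<bar>) \<le> M * (maj (s - r) * N)"
        by (intro mult_mono U V K_bound) (auto simp: MN maj_nonneg)
      then show ?thesis using True MN maj_nonneg[of "s - r"]
        by (simp add: F_def D_def abs_mult algebra_simps)
    qed (auto simp: F_def K_def)
    then show "AE z in lborel \<Otimes>\<^sub>M lborel. norm (F z) \<le> norm (D z)" by auto
  qed
  have left: "(\<integral>r. F (t, r) \<partial>lborel) = indicator {a..b} t *\<^sub>R (U t * integral {a..t} (\<lambda>r. k t r * V r))" for t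
  proof (cases "t \<in> {a..b}")
    case True
    then show ?thesis using integral_unique[OF left_has_integral[OF V True]] by (simp add: F_def)
  next
    case False
    then have "K t r = 0" for r by (auto simp: K_def)
    with False show ?thesis by (simp add: F_def)
  qed
  have right: "(\<integral>s. F (s, t) \<partial>lborel) = indicator {a..b} t *\<^sub>R (V t * integral {t..b} (\<lambda>r. k r t * U r))" for t
  proof (cases "t \<in> {a..b}")
    case True
    have "(\<integral>s. F (s, t) \<partial>lborel) = (\<integral>s. V t * (K s t * U s) \<partial>lborel)"
      by (simp add: F_def algebra_simps)
    then show ?thesis using integral_unique[OF right_has_integral[OF U True]] True by simp
  next
    case False
    then have "K r t = 0" for r by (auto simp: K_def)
    with False show ?thesis by (simp add: F_def)
  qed
  have 1: "set_integrable lborel {a..b} (\<lambda>t. U t * integral {a..t} (\<lambda>r. k t r * V r))"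
    unfolding set_integrable_def left[symmetric] using lborel_pair.integrable_fst'[OF F] .
  have 2: "set_integrable lborel {a..b} (\<lambda>t. V t * integral {t..b} (\<lambda>r. k r t * U r))"
    unfolding set_integrable_def right[symmetric]
    using lborel_pair.integrable_snd[of "\<lambda>x y. F (x, y)"] F by simp
  show "(\<lambda>t. U t * integral {a..t} (\<lambda>r. k t r * V r)) integrable_on {a..b}"
    "(\<lambda>t. V t * integral {t..b} (\<lambda>r. k r t * U r)) integrable_on {a..b}"
    using 1 2 by (auto intro: set_borel_integral_eq_integral(1))
  have "(\<integral>t. (\<integral>r. F (t, r) \<partial>lborel) \<partial>lborel) = (\<integral>t. (\<integral>s. F (s, t) \<partial>lborel) \<partial>lborel)"
    using lborel_pair.Fubini_integral[of "\<lambda>x y. F (x, y)"] F by simp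
  then show "integral {a..b} (\<lambda>t. U t * integral {a..t} (\<lambda>r. k t r * V r))
       = integral {a..b} (\<lambda>t. V t * integral {t..b} (\<lambda>r. k r t * U r))"
    using set_borel_integral_eq_integral(2)[OF 1] set_borel_integral_eq_integral(2)[OF 2]
    by (simp add: left right set_lebesgue_integral_def)
qed

end

section \<open>Continuity of integrals with a weakly singular kernel\<close>

lemma continuous_on_dominated_integral:
  fixes g :: "real \<Rightarrow> real \<Rightarrow> real"
  assumes meas: "\<And>t. t \<in> S \<Longrightarrow> g t \<in> borel_measurable lborel"
    and w: "integrable lborel w" and bound: "\<And>t x. t \<in> S \<Longrightarrow> \<bar>g t x\<bar> \<le> w x"
    and cont: "\<And>t. t \<in> S \<Longrightarrow> AE x in lborel. continuous (at t within S) (\<lambda>t. g t x)"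
  shows "continuous_on S (\<lambda>t. \<integral>x. g t x \<partial>lborel)"
  unfolding continuous_on_sequentially
proof (intro allI ballI impI)
  fix X t assume t: "t \<in> S" and X: "(\<forall>n. X n \<in> S) \<and> X \<longlonglongrightarrow> t"
  have "(\<lambda>n. \<integral>x. g (X n) x \<partial>lborel) \<longlonglongrightarrow> (\<integral>x. g t x \<partial>lborel)"
  proof (rule integral_dominated_convergence[OF _ _ w])
    show "AE x in lborel. (\<lambda>n. g (X n) x) \<longlonglongrightarrow> g t x"
      using cont[OF t]
    proof eventually_elim
      case (elim x)
      then show ?case
        using X unfolding continuous_within_sequentially by (auto simp: o_def)
    qed
  qed (use meas bound t X in auto)
  then show "((\<lambda>t. \<integral>x. g t x \<partial>lborel) \<circ> X) \<longlonglongrightarrow> (\<integral>x. g t x \<partial>lborel)"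
    by (simp add: o_def)
qed

context weakly_singular
begin

lemma continuous_extension_by_zero:
  assumes v: "continuous_on {a..b} v"
  obtains M where "(\<lambda>r. indicator {a..b} r *\<^sub>R v r) \<in> borel_measurable borel"
    and "\<And>r. \<bar>indicator {a..b} r *\<^sub>R v r :: real\<bar> \<le> M"
proof -
  obtain M where M: "\<forall>r\<in>{a..b}. \<bar>v r\<bar> \<le> M"
    using compact_imp_bounded[OF compact_continuous_image[OF v compact_Icc]]
    unfolding bounded_iff by auto
  moreover from M[rule_format, of a] ab have "0 \<le> M" by auto
  ultimately have "\<bar>indicator {a..b} r *\<^sub>R v r :: real\<bar> \<le> M" for r
    by (auto simp: indicator_def)
  then show thesis
    by (intro that borel_measurable_continuous_on_indicator v) auto
qed

lemma left_integral_lborel: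
  assumes v: "continuous_on {a..b} v" and t: "t \<in> {a..b}"
  shows "((\<lambda>r. k t r * v r) has_integral
           (\<integral>x. K t (t - x) * (indicator {a..b} (t - x) *\<^sub>R v (t - x)) \<partial>lborel)) {a..t}"
proof -
  let ?V = "\<lambda>r. indicator {a..b} r *\<^sub>R v r"
  obtain M where "?V \<in> borel_measurable borel" "\<And>r. \<bar>?V r\<bar> \<le> M"
    using continuous_extension_by_zero[OF v] by blast
  from left_has_integral[OF this t]
  have "((\<lambda>r. k t r * v r) has_integral (\<integral>r. K t r * ?V r \<partial>lborel)) {a..t}"
    by (rule has_integral_eq[rotated]) (use t in \<open>auto simp: indicator_def\<close>)
  then show ?thesis
    using lborel_integral_real_affine[of "-1" "\<lambda>r. K t r * ?V r" t] by simp
qed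

lemma right_integral_lborel:
  assumes v: "continuous_on {a..b} v" and t: "t \<in> {a..b}"
  shows "((\<lambda>r. k r t * v r) has_integral
           (\<integral>x. K (t + x) t * (indicator {a..b} (t + x) *\<^sub>R v (t + x)) \<partial>lborel)) {t..b}"
proof -
  let ?V = "\<lambda>r. indicator {a..b} r *\<^sub>R v r"
  obtain M where "?V \<in> borel_measurable borel" "\<And>r. \<bar>?V r\<bar> \<le> M"
    using continuous_extension_by_zero[OF v] by blast
  from right_has_integral[OF this t]
  have "((\<lambda>r. k r t * v r) has_integral (\<integral>r. K r t * ?V r \<partial>lborel)) {t..b}"
    by (rule has_integral_eq[rotated]) (use t in \<open>auto simp: indicator_def\<close>)
  then show ?thesis
    using lborel_integral_real_affine[of "1" "\<lambda>r. K r t * ?V r" t] by simp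
qed

text \<open>After the substitution \<open>r = t - x\<close> the singularity sits at \<open>x = 0\<close> for every \<open>t\<close>, so
  that a single integrable majorant is available.\<close>

lemma left_integral_continuous:
  assumes v: "continuous_on {a..b} v"
  shows "continuous_on {a..b} (\<lambda>t. integral {a..t} (\<lambda>r. k t r * v r))"
proof -
  let ?V = "\<lambda>r. indicator {a..b} r *\<^sub>R v r"
  let ?g = "\<lambda>t x. K t (t - x) * ?V (t - x)"
  obtain M where V: "?V \<in> borel_measurable borel" "\<And>r. \<bar>?V r\<bar> \<le> M"
    using continuous_extension_by_zero[OF v] by blast
  have "continuous_on {a..b} (\<lambda>t. \<integral>x. ?g t x \<partial>lborel)"
  proof (rule continuous_on_dominated_integral)
    show "integrable lborel (\<lambda>x. maj x * M)" using maj_integrable by simp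
    show "\<bar>?g t x\<bar> \<le> maj x * M" for t x
      using mult_mono[OF K_bound[of t "t - x"] V(2)[of "t - x"] maj_nonneg] by (simp add: abs_mult)
    show "?g t \<in> borel_measurable lborel" for t
    proof -
      have m: "(\<lambda>x. t - x) \<in> borel \<rightarrow>\<^sub>M borel" by simp
      have "(\<lambda>x. K t (t - x)) \<in> borel_measurable borel"
        using measurable_compose[OF m K_measurable_snd] .
      moreover have "(\<lambda>x. ?V (t - x)) \<in> borel_measurable borel"
        using measurable_compose[OF m V(1)] .
      ultimately have "?g t \<in> borel_measurable borel" by (rule borel_measurable_times)
      then show ?thesis by simp
    qed
    fix t assume t: "t \<in> {a..b}"
    \<comment> \<open>The zero extension jumps in t where t - x = a. This single value of x, which
      depends on t, is discarded; for any other x the integrand is, near t, either 0 or given by the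
      continuous kernel.\<close>
    have "AE x in lborel. x \<noteq> t - a" by (rule AE_lborel_singleton)
    then show "AE x in lborel. continuous (at t within {a..b}) (\<lambda>t. ?g t x)"
    proof eventually_elim
      case (elim x)
      consider "x \<le> 0" | "0 < x" "t < a + x" | "0 < x" "a + x < t" using elim by linarith
      then show ?case
      proof cases
        case 1
        then have "K s (s - x) = 0" for s by (simp add: K_def)
        then show ?thesis by simp
      next
        case 2
        have "\<forall>\<^sub>F s in at t within {a..b}. s < a + x"
          using 2 t by (intro order_tendstoD(2)[OF tendsto_ident_at]) auto
        then have "\<forall>\<^sub>F s in at t within {a..b}. 0 = ?g s x"
          by eventually_elim (simp add: K_def)
        from Lim_transform_eventually[OF tendsto_const this]
        have "((\<lambda>s. ?g s x) \<longlongrightarrow> 0) (at t within {a..b})" .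
        moreover have z: "?g t x = 0" using 2 by (simp add: K_def)
        ultimately show ?thesis unfolding continuous_within z by blast
      next
        case 3
        have "continuous_on {a + x..b} (\<lambda>s. (\<lambda>(s, r). k s r) (s, s - x) * v (s - x))"
        proof (intro continuous_on_mult)
          show "continuous_on {a + x..b} (\<lambda>s. (\<lambda>(s, r). k s r) (s, s - x))"
            by (rule continuous_on_compose2[OF k_cont]) (use 3 in \<open>auto intro!: continuous_intros\<close>)
          show "continuous_on {a + x..b} (\<lambda>s. v (s - x))"
            by (rule continuous_on_compose2[OF v]) (use 3 in \<open>auto intro!: continuous_intros\<close>)
        qed
        then have "continuous_on {a + x..b} (\<lambda>s. ?g s x)"
          by (rule continuous_on_eq) (use 3 in \<open>auto simp: K_def\<close>)
        then have "continuous (at t within {a + x..b}) (\<lambda>s. ?g s x)"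
          using 3 t by (auto simp: continuous_on_eq_continuous_within)
        \<comment> \<open>Since a + x < t, the truncation at a + x is invisible near t.\<close>
        moreover have "at t within {a + x..b} = at t within {a..b}"
          by (rule at_within_nhd[of _ "{a + x<..}"]) (use 3 in auto)
        ultimately show ?thesis by simp
      qed
    qed
  qed
  then show ?thesis
    by (rule continuous_on_eq) (use integral_unique[OF left_integral_lborel[OF v]] in auto)
qed

text \<open>Mirror image of the left case: the substitution r = t + x keeps the singularity at x =
  0, and the value to discard is x = b - t.\<close>

lemma right_integral_continuous:
  assumes v: "continuous_on {a..b} v"
  shows "continuous_on {a..b} (\<lambda>t. integral {t..b} (\<lambda>r. k r t * v r))"
proof -
  let ?V = "\<lambda>r. indicator {a..b} r *\<^sub>R v r"
  let ?g = "\<lambda>t x. K (t + x) t * ?V (t + x)"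
  obtain M where V: "?V \<in> borel_measurable borel" "\<And>r. \<bar>?V r\<bar> \<le> M"
    using continuous_extension_by_zero[OF v] by blast
  have "continuous_on {a..b} (\<lambda>t. \<integral>x. ?g t x \<partial>lborel)"
  proof (rule continuous_on_dominated_integral)
    show "integrable lborel (\<lambda>x. maj x * M)" using maj_integrable by simp
    show "\<bar>?g t x\<bar> \<le> maj x * M" for t x
      using mult_mono[OF K_bound[of "t + x" t] V(2)[of "t + x"] maj_nonneg] by (simp add: abs_mult)
    show "?g t \<in> borel_measurable lborel" for t
    proof -
      have m: "(\<lambda>x. t + x) \<in> borel \<rightarrow>\<^sub>M borel" by simp
      have "(\<lambda>x. K (t + x) t) \<in> borel_measurable borel"
        using measurable_compose[OF m K_measurable_fst] .
      moreover have "(\<lambda>x. ?V (t + x)) \<in> borel_measurable borel"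
        using measurable_compose[OF m V(1)] .
      ultimately have "?g t \<in> borel_measurable borel" by (rule borel_measurable_times)
      then show ?thesis by simp
    qed
    fix t assume t: "t \<in> {a..b}"
    have "AE x in lborel. x \<noteq> b - t" by (rule AE_lborel_singleton)
    then show "AE x in lborel. continuous (at t within {a..b}) (\<lambda>t. ?g t x)"
    proof eventually_elim
      case (elim x)
      consider "x \<le> 0" | "0 < x" "b - x < t" | "0 < x" "t < b - x" using elim by linarith
      then show ?case
      proof cases
        case 1
        then have "K (s + x) s = 0" for s by (simp add: K_def)
        then show ?thesis by simp
      next
        case 2
        have "\<forall>\<^sub>F s in at t within {a..b}. b - x < s"
          using 2 t by (intro order_tendstoD(1)[OF tendsto_ident_at]) auto
        then have "\<forall>\<^sub>F s in at t within {a..b}. 0 = ?g s x"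
          by eventually_elim (simp add: K_def)
        from Lim_transform_eventually[OF tendsto_const this]
        have "((\<lambda>s. ?g s x) \<longlongrightarrow> 0) (at t within {a..b})" .
        moreover have z: "?g t x = 0" using 2 by (simp add: K_def)
        ultimately show ?thesis unfolding continuous_within z by blast
      next
        case 3
        have "continuous_on {a..b - x} (\<lambda>s. (\<lambda>(s, r). k s r) (s + x, s) * v (s + x))"
        proof (intro continuous_on_mult)
          show "continuous_on {a..b - x} (\<lambda>s. (\<lambda>(s, r). k s r) (s + x, s))"
            by (rule continuous_on_compose2[OF k_cont]) (use 3 in \<open>auto intro!: continuous_intros\<close>)
          show "continuous_on {a..b - x} (\<lambda>s. v (s + x))"
            by (rule continuous_on_compose2[OF v]) (use 3 in \<open>auto intro!: continuous_intros\<close>)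
        qed
        then have "continuous_on {a..b - x} (\<lambda>s. ?g s x)"
          by (rule continuous_on_eq) (use 3 in \<open>auto simp: K_def\<close>)
        then have "continuous (at t within {a..b - x}) (\<lambda>s. ?g s x)"
          using 3 t by (auto simp: continuous_on_eq_continuous_within)
        moreover have "at t within {a..b - x} = at t within {a..b}"
          by (rule at_within_nhd[of _ "{..<b - x}"]) (use 3 in auto)
        ultimately show ?thesis by simp
      qed
    qed
  qed
  then show ?thesis
    by (rule continuous_on_eq) (use integral_unique[OF right_integral_lborel[OF v]] in auto)
qed

end

section \<open>The fractional kernel is weakly singular\<close>

lemma powr_le_one_plus:
  fixes x q :: real
  assumes "0 < x" "0 \<le> q" "q \<le> 1"
  shows "x powr q \<le> 1 + x"
proof (cases "x \<le> 1")
  case True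
  then show ?thesis using powr_le1[of q x] assms by linarith
next
  case False
  then have "x powr q \<le> x powr 1" using assms by (intro powr_mono) auto
  then show ?thesis using assms by simp
qed

text \<open>Put p = i - \<delta>, with values in (0,1); the kernel has exponent p - 1. By
  compactness p attains a positive minimum \<open>\<mu>\<close> and 1/Gamma(p) has an upper bound
  \<open>G\<close>. Splitting off the power \<mu> - 1 leaves the exponent p - \<mu> in [0,1], and
  that factor is at most 1 + (s - r). This is the origin of the constant
  \<open>G * (1 + (b - a))\<close>.\<close>

lemma fkernel_weakly_singular:
  fixes a b :: real
  assumes "a \<le> b" and cont: "continuous_on ({a..b} \<times> {a..b}) \<delta>"
    and range: "\<delta> ` ({a..b} \<times> {a..b}) \<subseteq> {real i - 1<..<real i}"
  obtains C \<mu> where "\<And>c e. a \<le> c \<Longrightarrow> c \<le> e \<Longrightarrow> e \<le> b \<Longrightarrow> weakly_singular c e C \<mu> (fkernel i \<delta>)"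
proof -
  let ?Q = "{a..b} \<times> {a..b}"
  define p where "p z = real i - \<delta> z" for z
  have Q: "compact ?Q" "?Q \<noteq> {}" using \<open>a \<le> b\<close> by (auto intro: compact_Times)
  have cp: "continuous_on ?Q p" unfolding p_def by (intro continuous_intros cont)
  have p: "0 < p z \<and> p z < 1" if "z \<in> ?Q" for z
  proof -
    have "\<delta> z \<in> {real i - 1<..<real i}" using range that by blast
    then show ?thesis by (simp add: p_def)
  qed
  obtain z0 where z0: "z0 \<in> ?Q" "\<And>z. z \<in> ?Q \<Longrightarrow> p z0 \<le> p z"
    using continuous_attains_inf[OF Q cp] by blast
  define \<mu> where "\<mu> = p z0"
  have \<mu>: "0 < \<mu>" using p[OF z0(1)] by (simp add: \<mu>_def)
  have "continuous_on ?Q (\<lambda>z. inverse (Gamma (p z)))"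
  proof (rule continuous_on_inverse)
    show "continuous_on ?Q (\<lambda>z. Gamma (p z))"
      by (rule continuous_on_compose2[OF continuous_on_Gamma cp, of "{0<..}"])
        (use p in \<open>auto elim!: nonpos_Ints_cases\<close>)
    show "\<forall>z\<in>?Q. Gamma (p z) \<noteq> 0"
      using p Gamma_real_pos by (metis less_irrefl)
  qed
  then obtain z1 where "\<And>z. z \<in> ?Q \<Longrightarrow> inverse (Gamma (p z)) \<le> inverse (Gamma (p z1))"
    using continuous_attains_sup[OF Q] by blast
  then obtain G where G: "\<And>z. z \<in> ?Q \<Longrightarrow> inverse (Gamma (p z)) \<le> G" by blast
  have kernel: "fkernel i \<delta> s r = (s - r) powr (p (s, r) - 1) * inverse (Gamma (p (s, r)))" for s r
    by (simp add: fkernel_def p_def divide_inverse algebra_simps)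
  have "weakly_singular c e (G * (1 + (b - a))) \<mu> (fkernel i \<delta>)" if "a \<le> c" "c \<le> e" "e \<le> b" for c e
  proof
    show "c \<le> e" "0 < \<mu>" by fact+
    show "fkernel i \<delta> s s = 0" for s by (simp add: fkernel_def)
    let ?S = "{(s, r). c \<le> r \<and> r < s \<and> s \<le> e}"
    have S: "?S \<subseteq> ?Q" using that by auto
    show "continuous_on ?S (\<lambda>(s, r). fkernel i \<delta> s r)"
    proof -
      have "continuous_on ?S p" "continuous_on ?S (\<lambda>z. inverse (Gamma (p z)))"
        by (rule continuous_on_subset[OF _ S], fact)+
      then have "continuous_on ?S (\<lambda>z. (fst z - snd z) powr (p z - 1) * inverse (Gamma (p z)))"
        by (intro continuous_on_mult continuous_on_powr continuous_on_diff continuous_on_fst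
            continuous_on_snd continuous_on_id continuous_on_const) auto
      then show ?thesis by (simp add: kernel case_prod_beta')
    qed
    fix s r assume sr: "c \<le> r" "r < s" "s \<le> e"
    then have z: "(s, r) \<in> ?Q" using that by auto
    have q: "0 \<le> p (s, r) - \<mu>" "p (s, r) - \<mu> \<le> 1"
      using z0(2)[OF z] p[OF z] \<mu> by (auto simp: \<mu>_def)
    have "(s - r) powr (p (s, r) - 1) = (s - r) powr (p (s, r) - \<mu>) * (s - r) powr (\<mu> - 1)"
      by (simp add: powr_add[symmetric])
    also have "\<dots> \<le> (1 + (b - a)) * (s - r) powr (\<mu> - 1)"
      using powr_le_one_plus[OF _ q, of "s - r"] sr that by (intro mult_right_mono) auto
    finally have "(s - r) powr (p (s, r) - 1) * inverse (Gamma (p (s, r)))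
        \<le> ((1 + (b - a)) * (s - r) powr (\<mu> - 1)) * G"
      using G[OF z] p[OF z] \<open>a \<le> b\<close> by (intro mult_mono) (auto intro!: less_imp_le Gamma_real_pos)
    then show "\<bar>fkernel i \<delta> s r\<bar> \<le> G * (1 + (b - a)) * (s - r) powr (\<mu> - 1)"
      using p[OF z] Gamma_real_pos[of "p (s, r)"] by (simp add: kernel algebra_simps)
  qed
  then show thesis by (rule that)
qed

section \<open>Fractional integrals of variable order: continuity, restriction, duality\<close>

locale variable_order =
  fixes a b :: real and i :: nat and \<delta> :: "real \<times> real \<Rightarrow> real"
  assumes ab: "a \<le> b" and cont: "continuous_on ({a..b} \<times> {a..b}) \<delta>"
    and range: "\<delta> ` ({a..b} \<times> {a..b}) \<subseteq> {real i - 1<..<real i}"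
begin

text \<open>Gives access to the right integral based at \<open>T\<close> on \<open>{a..T}\<close>
  and to the left one based at \<open>T\<close> on \<open>{T..b}\<close>.\<close>

lemma subinterval:
  assumes "a \<le> c" "c \<le> e" "e \<le> b"
  shows "variable_order c e i \<delta>"
proof
  have "{c..e} \<times> {c..e} \<subseteq> {a..b} \<times> {a..b}" using assms by auto
  then show "continuous_on ({c..e} \<times> {c..e}) \<delta>" "\<delta> ` ({c..e} \<times> {c..e}) \<subseteq> {real i - 1<..<real i}"
    using continuous_on_subset[OF cont] range by blast+
qed fact

lemma weakly_singular_fkernel: obtains C \<mu> where "weakly_singular a b C \<mu> (fkernel i \<delta>)"
proof (rule fkernel_weakly_singular[OF ab cont range])
  fix C \<mu> assume "\<And>c e. a \<le> c \<Longrightarrow> c \<le> e \<Longrightarrow> e \<le> b \<Longrightarrow> weakly_singular c e C \<mu> (fkernel i \<delta>)"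
  from this[OF order_refl ab order_refl] show thesis by (rule that)
qed

lemma left_int_continuous:
  assumes "continuous_on {a..b} v"
  shows "continuous_on {a..b} (left_int i \<delta> a v)"
proof -
  obtain C \<mu> where "weakly_singular a b C \<mu> (fkernel i \<delta>)" by (rule weakly_singular_fkernel)
  from weakly_singular.left_integral_continuous[OF this assms] show ?thesis
    by (simp add: left_int_def[abs_def])
qed

lemma right_int_continuous:
  assumes "continuous_on {a..b} v"
  shows "continuous_on {a..b} (right_int i \<delta> b v)"
proof -
  obtain C \<mu> where "weakly_singular a b C \<mu> (fkernel i \<delta>)" by (rule weakly_singular_fkernel)
  from weakly_singular.right_integral_continuous[OF this assms] show ?thesis
    by (simp add: right_int_def[abs_def])
qed

lemma left_integrable:
  assumes "continuous_on {a..b} v" "t \<in> {a..b}"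
  shows "(\<lambda>\<tau>. fkernel i \<delta> t \<tau> * v \<tau>) integrable_on {a..t}"
proof -
  obtain C \<mu> where "weakly_singular a b C \<mu> (fkernel i \<delta>)" by (rule weakly_singular_fkernel)
  from weakly_singular.left_integral_lborel[OF this assms] show ?thesis
    by (rule has_integral_integrable)
qed

lemma right_integrable:
  assumes "continuous_on {a..b} v" "t \<in> {a..b}"
  shows "(\<lambda>\<tau>. fkernel i \<delta> \<tau> t * v \<tau>) integrable_on {t..b}"
proof -
  obtain C \<mu> where "weakly_singular a b C \<mu> (fkernel i \<delta>)" by (rule weakly_singular_fkernel)
  from weakly_singular.right_integral_lborel[OF this assms] show ?thesis
    by (rule has_integral_integrable)
qed

lemma left_int_swap:
  assumes u: "continuous_on {a..b} u" and v: "continuous_on {a..b} v"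
  shows "integral {a..b} (\<lambda>t. u t * left_int i \<delta> a v t) = integral {a..b} (\<lambda>t. v t * right_int i \<delta> b u t)"
proof -
  obtain C \<mu> where "weakly_singular a b C \<mu> (fkernel i \<delta>)" by (rule weakly_singular_fkernel)
  then interpret weakly_singular a b C \<mu> "fkernel i \<delta>" .
  let ?U = "\<lambda>r. indicator {a..b} r *\<^sub>R u r" and ?V = "\<lambda>r. indicator {a..b} r *\<^sub>R v r"
  obtain M where U: "?U \<in> borel_measurable borel" "\<And>r. \<bar>?U r\<bar> \<le> M"
    using continuous_extension_by_zero[OF u] by blast
  obtain N where V: "?V \<in> borel_measurable borel" "\<And>r. \<bar>?V r\<bar> \<le> N"
    using continuous_extension_by_zero[OF v] by blast
  have "integral {a..b} (\<lambda>t. u t * left_int i \<delta> a v t)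
      = integral {a..b} (\<lambda>t. ?U t * integral {a..t} (\<lambda>r. fkernel i \<delta> t r * ?V r))"
    unfolding left_int_def
    by (intro integral_cong arg_cong2[where f = "(*)"]) (auto intro!: integral_cong)
  also have "\<dots> = integral {a..b} (\<lambda>t. ?V t * integral {t..b} (\<lambda>r. fkernel i \<delta> r t * ?U r))"
    by (rule integral_swap[OF U V])
  also have "\<dots> = integral {a..b} (\<lambda>t. v t * right_int i \<delta> b u t)"
    unfolding right_int_def
    by (intro integral_cong arg_cong2[where f = "(*)"]) (auto intro!: integral_cong)
  finally show ?thesis .
qed

text \<open>The region t \<le> T, t \<le> r \<le> b reaches past \<open>T\<close>. Fubini on
  \<open>{a..b}\<close>, applied to \<open>u\<close> cut off at \<open>T\<close>, leaves at times t
  \<ge> T an inner integral over \<open>{a..T}\<close>, which is the difference of the left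
  integrals of \<open>u\<close> based at \<open>a\<close> and at \<open>T\<close>. Here the
  conditions on \<open>{T..b}\<close> originate.\<close>

lemma right_int_swap:
  assumes T: "T \<in> {a..b}" and u: "continuous_on {a..b} u" and v: "continuous_on {a..b} v"
  shows "integral {a..T} (\<lambda>t. u t * right_int i \<delta> b v t)
       = integral {a..T} (\<lambda>t. v t * left_int i \<delta> a u t)
         + integral {T..b} (\<lambda>t. v t * (left_int i \<delta> a u t - left_int i \<delta> T u t))"
proof -
  obtain C \<mu> where "weakly_singular a b C \<mu> (fkernel i \<delta>)" by (rule weakly_singular_fkernel)
  then interpret weakly_singular a b C \<mu> "fkernel i \<delta>" .
  let ?U = "\<lambda>r. indicator {a..b} r *\<^sub>R v r" and ?u = "\<lambda>r. indicator {a..b} r *\<^sub>R u r"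
  define V where "V r = indicator {a..T} r *\<^sub>R u r" for r
  obtain M where U: "?U \<in> borel_measurable borel" "\<And>r. \<bar>?U r\<bar> \<le> M"
    using continuous_extension_by_zero[OF v] by blast
  obtain N where N: "\<And>r. \<bar>?u r\<bar> \<le> N"
    using continuous_extension_by_zero[OF u] by blast
  have V_bound: "\<bar>V r\<bar> \<le> N" for r
  proof (cases "r \<in> {a..T}")
    case True
    then have "V r = ?u r" using T by (auto simp: V_def)
    then show ?thesis using N[of r] by simp
  next
    case False
    then have "V r = 0" by (simp add: V_def)
    then show ?thesis using order_trans[OF abs_ge_zero N[of r]] by simp
  qed
  have V_meas: "V \<in> borel_measurable borel"
    unfolding V_def using T
    by (intro borel_measurable_continuous_on_indicator continuous_on_subset[OF u]) auto
  note sw = integral_swap[OF U V_meas V_bound]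
  let ?l = "\<lambda>t. ?U t * integral {a..t} (\<lambda>r. fkernel i \<delta> t r * V r)"
  have "integral {a..T} (\<lambda>t. u t * right_int i \<delta> b v t)
      = integral {a..b} (\<lambda>t. if t \<in> {a..T} then u t * right_int i \<delta> b v t else 0)"
    using T by (simp only: Henstock_Kurzweil_Integration.integral_restrict_Int) (simp add: Int_absorb2)
  also have "\<dots> = integral {a..b} (\<lambda>t. V t * integral {t..b} (\<lambda>r. fkernel i \<delta> r t * ?U r))"
    using T unfolding right_int_def
    by (intro integral_cong) (auto simp: V_def intro!: integral_cong)
  also have "\<dots> = integral {a..b} ?l" using sw(1) by simp
  also have "\<dots> = integral {a..T} ?l + integral {T..b} ?l"
    using T by (intro Henstock_Kurzweil_Integration.integral_combine[symmetric] sw(2)) auto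
  also have "integral {a..T} ?l = integral {a..T} (\<lambda>t. v t * left_int i \<delta> a u t)"
    unfolding left_int_def using T
    by (intro integral_cong arg_cong2[where f = "(*)"]) (auto simp: V_def intro!: integral_cong)
  also have "integral {T..b} ?l = integral {T..b} (\<lambda>t. v t * (left_int i \<delta> a u t - left_int i \<delta> T u t))"
  proof (intro integral_cong arg_cong2[where f = "(*)"])
    fix t assume t: "t \<in> {T..b}"
    then show "?U t = v t" using T by auto
    let ?k = "\<lambda>r. fkernel i \<delta> t r * u r"
    have "integral {a..t} (\<lambda>r. fkernel i \<delta> t r * V r) = integral {a..t} (\<lambda>r. if r \<in> {a..T} then ?k r else 0)"
      by (intro integral_cong) (auto simp: V_def)
    also have "\<dots> = integral {a..T} ?k"
      using t by (simp only: Henstock_Kurzweil_Integration.integral_restrict_Int) (simp add: Int_absorb2)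
    also have "\<dots> = left_int i \<delta> a u t - left_int i \<delta> T u t"
    proof -
      have "?k integrable_on {a..t}" using t T by (intro left_integrable u) auto
      then have "integral {a..T} ?k + integral {T..t} ?k = integral {a..t} ?k"
        using t T by (intro Henstock_Kurzweil_Integration.integral_combine) auto
      then show ?thesis by (simp add: left_int_def)
    qed
    finally show "integral {a..t} (\<lambda>r. fkernel i \<delta> t r * V r) = left_int i \<delta> a u t - left_int i \<delta> T u t" .
  qed
  finally show ?thesis .
qed

end

section \<open>Reduction of the first variation\<close>

text \<open>The antiderivative of -w is normalized to have the value \<open>\<kappa>\<close> at
  \<open>e\<close>. Leaving \<open>\<kappa>\<close> free allows the boundary term at
  \<open>e\<close> to be prescribed.\<close>

lemma integration_by_parts_tail:
  fixes w h h' :: "real \<Rightarrow> real"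
  assumes "c \<le> e" and w: "continuous_on {c..e} w" and h': "continuous_on {c..e} h'"
    and h: "\<And>t. t \<in> {c..e} \<Longrightarrow> (h has_real_derivative h' t) (at t within {c..e})"
  shows "integral {c..e} (\<lambda>t. w t * h t) =
     (\<kappa> + integral {c..e} w) * h c - \<kappa> * h e + integral {c..e} (\<lambda>t. (\<kappa> + integral {t..e} w) * h' t)"
proof -
  let ?K = "\<lambda>t. \<kappa> + integral {t..e} w"
  have K: "(?K has_real_derivative - w t) (at t within {c..e})" if "t \<in> {c..e}" for t
    using integral_has_real_derivative'[OF w that] by (auto intro!: derivative_eq_intros)
  have ch: "continuous_on {c..e} h"
    by (rule DERIV_continuous_on[OF h])
  have cK: "continuous_on {c..e} ?K"
    by (rule DERIV_continuous_on[OF K])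
  have "((\<lambda>t. ?K t * h' t - w t * h t) has_integral ?K e * h e - ?K c * h c) {c..e}"
  proof (rule fundamental_theorem_of_calculus[OF \<open>c \<le> e\<close>])
    fix t assume "t \<in> {c..e}"
    then show "((\<lambda>t. ?K t * h t) has_vector_derivative ?K t * h' t - w t * h t) (at t within {c..e})"
      using DERIV_mult[OF K h, of t] unfolding has_real_derivative_iff_has_vector_derivative[symmetric]
      by (simp add: algebra_simps)
  qed
  then have "integral {c..e} (\<lambda>t. ?K t * h' t - w t * h t) = ?K e * h e - ?K c * h c"
    by (rule integral_unique)
  moreover have "integral {c..e} (\<lambda>t. ?K t * h' t - w t * h t)
      = integral {c..e} (\<lambda>t. ?K t * h' t) - integral {c..e} (\<lambda>t. w t * h t)"
    by (intro integral_diff integrable_continuous_real continuous_intros cK ch w h')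
  ultimately show ?thesis by simp
qed

text \<open>The function with index m is the coefficient of h^(m) once all terms of the first
  variation of order at most m are merged into one integral. Integrating that integral by parts,
  with constant \<open>\<kappa> m\<close> at \<open>e\<close>, and adding the term of order m + 1
  gives the next coefficient.\<close>

primrec tails :: "(nat \<Rightarrow> real \<Rightarrow> real) \<Rightarrow> (nat \<Rightarrow> real) \<Rightarrow> real \<Rightarrow> (real \<Rightarrow> real) \<Rightarrow> nat \<Rightarrow> real \<Rightarrow> real" where
  "tails P \<kappa> e w 0 = w"
| "tails P \<kappa> e w (Suc m) = (\<lambda>t. P (Suc m) t + \<kappa> m + integral {t..e} (tails P \<kappa> e w m))"

lemma tails_continuous:
  assumes "continuous_on {c..e} w" and P: "\<And>i. i \<in> {1..n} \<Longrightarrow> continuous_on {c..e} (P i)" and "m \<le> n"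
  shows "continuous_on {c..e} (tails P \<kappa> e w m)"
  using \<open>m \<le> n\<close>
proof (induction m)
  case (Suc m)
  then have "continuous_on {c..e} (\<lambda>t. integral {t..e} (tails P \<kappa> e w m))"
    by (auto intro!: DERIV_continuous_on integral_has_real_derivative')
  with Suc show ?case by (auto intro!: continuous_intros P)
qed (use assms in simp)

text \<open>Once the last function of the recursion vanishes, all earlier ones are read off by
  differentiating downwards.\<close>

lemma tails_vanish:
  assumes "c < e" and w: "continuous_on {c..e} w"
    and P: "\<And>i. i \<in> {1..n} \<Longrightarrow> times_differentiable_on i (P i) {c..e}"
    and zero: "\<And>t. t \<in> {c..e} \<Longrightarrow> tails P \<kappa> e w n t = 0"
  shows tails_vanish_deriv: "\<And>t. m \<le> n \<Longrightarrow> t \<in> {c..e} \<Longrightarrow>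
      tails P \<kappa> e w m t = - (\<Sum>i=Suc m..n. (-1) ^ (i - m) * nderiv {c..e} (i - m) (P i) t)"
    and tails_vanish_integral: "\<And>t. m < n \<Longrightarrow> t \<in> {c..e} \<Longrightarrow>
      \<kappa> m + integral {t..e} (tails P \<kappa> e w m)
        = (\<Sum>i=Suc m..n. (-1) ^ (i - m) * nderiv {c..e} (i - 1 - m) (P i) t)"
proof -
  let ?S = "{c..e}" and ?w = "tails P \<kappa> e w"
  have cw: "continuous_on ?S (?w m)" if "m \<le> n" for m
  proof (rule tails_continuous[OF w _ that])
    fix i assume i: "i \<in> {1..n}"
    then have "continuous_on ?S (nderiv ?S 0 (P i))"
      by (intro nderiv_continuous_on[OF P]) auto
    then show "continuous_on ?S (P i)" by simp
  qed
  \<comment> \<open>The recursion is solved for the constant plus integral: the isolated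
    \<open>P (Suc m)\<close> supplies the term i = m + 1 of the new sum, and every other sign
    flips.\<close>
  have down: "\<kappa> m + integral {t..e} (?w m) = (\<Sum>i=Suc m..n. (-1) ^ (i - m) * nderiv ?S (i - 1 - m) (P i) t)"
    if m: "Suc m \<le> n" and t: "t \<in> ?S"
      and eq: "?w (Suc m) t = - (\<Sum>i=Suc (Suc m)..n. (-1) ^ (i - Suc m) * nderiv ?S (i - Suc m) (P i) t)"
    for m t
  proof -
    have "(\<Sum>i=Suc m..n. (-1) ^ (i - m) * nderiv ?S (i - 1 - m) (P i) t)
        = - P (Suc m) t + (\<Sum>i=Suc (Suc m)..n. (-1) ^ (i - m) * nderiv ?S (i - 1 - m) (P i) t)"
      using m by (subst sum.atLeast_Suc_atMost) auto
    also have "(\<Sum>i=Suc (Suc m)..n. (-1) ^ (i - m) * nderiv ?S (i - 1 - m) (P i) t)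
        = (\<Sum>i=Suc (Suc m)..n. - ((-1) ^ (i - Suc m) * nderiv ?S (i - Suc m) (P i) t))"
    proof (rule sum.cong)
      fix i assume "i \<in> {Suc (Suc m)..n}"
      then have "i - m = Suc (i - Suc m)" "i - 1 - m = i - Suc m" by auto
      then show "(-1) ^ (i - m) * nderiv ?S (i - 1 - m) (P i) t
          = - ((-1) ^ (i - Suc m) * nderiv ?S (i - Suc m) (P i) t)" by (simp del: nderiv.simps)
    qed simp
    finally show ?thesis using eq by (simp add: sum_negf)
  qed
  have deriv: "?w m t = - (\<Sum>i=Suc m..n. (-1) ^ (i - m) * nderiv ?S (i - m) (P i) t)"
    if "m \<le> n" "t \<in> ?S" for m t
    using that
  proof (induction m arbitrary: t rule: inc_induct)
    case base
    then show ?case using zero by simp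
  next
    case (step m)
    have I: "\<kappa> m + integral {s..e} (?w m)
        = (\<Sum>i=Suc m..n. (-1) ^ (i - m) * nderiv ?S (i - 1 - m) (P i) s)" if "s \<in> ?S" for s
      using \<open>m < n\<close> that step.IH down by simp
    \<comment> \<open>By the fundamental theorem this side has derivative -w_m, because w_m is
      continuous. On the other side only orders i - 1 - m < i are differentiated, as the hypothesis
      on \<open>P i\<close> permits; continuity of the resulting derivatives is never
      invoked.\<close>
    have D1: "((\<lambda>s. \<kappa> m + integral {s..e} (?w m)) has_real_derivative - ?w m t) (at t within ?S)"
      using integral_has_real_derivative'[OF cw step.prems] \<open>m < n\<close>
      by (auto intro!: derivative_eq_intros)
    have "((\<lambda>s. \<Sum>i=Suc m..n. (-1) ^ (i - m) * nderiv ?S (i - 1 - m) (P i) s) has_real_derivative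
        (\<Sum>i=Suc m..n. (-1) ^ (i - m) * nderiv ?S (i - m) (P i) t)) (at t within ?S)"
    proof (intro DERIV_sum DERIV_cmult)
      fix i assume "i \<in> {Suc m..n}"
      then have "i \<in> {1..n}" "i - 1 - m < i" and eq: "i - m = Suc (i - 1 - m)" by auto
      then show "(nderiv ?S (i - 1 - m) (P i) has_real_derivative nderiv ?S (i - m) (P i) t) (at t within ?S)"
        unfolding eq by (intro nderiv_has_real_derivative[OF P] step.prems)
    qed
    then have "((\<lambda>s. \<kappa> m + integral {s..e} (?w m)) has_real_derivative
        (\<Sum>i=Suc m..n. (-1) ^ (i - m) * nderiv ?S (i - m) (P i) t)) (at t within ?S)"
      by (rule has_field_derivative_transform_within[OF _ zero_less_one]) (use step.prems I in auto)
    then have "(\<Sum>i=Suc m..n. (-1) ^ (i - m) * nderiv ?S (i - m) (P i) t) = - ?w m t"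
      by (rule DERIV_unique_within_interval[OF \<open>c < e\<close> step.prems _ D1])
    then show ?case by simp
  qed
  fix m t assume t: "t \<in> ?S"
  show "m \<le> n \<Longrightarrow> ?w m t = - (\<Sum>i=Suc m..n. (-1) ^ (i - m) * nderiv ?S (i - m) (P i) t)"
    using deriv t by blast
  show "\<kappa> m + integral {t..e} (?w m) = (\<Sum>i=Suc m..n. (-1) ^ (i - m) * nderiv ?S (i - 1 - m) (P i) t)"
    if "m < n" by (rule down[OF _ t deriv[OF _ t]]) (use that in auto)
qed

text \<open>A fundamental lemma for two functions that may disagree at \<open>T\<close>. The test
  function is \<open>u\<close> on the left and \<open>v\<close> on the right, multiplied by |T - t|:
  the factor makes the glued function continuous and both integrals nonnegative. It loses the point
  \<open>T\<close>, which is recovered by continuity.\<close>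

lemma continuous_two_sided_vanish:
  fixes u v :: "real \<Rightarrow> real"
  assumes "a < T" "T < b" and u: "continuous_on {a..T} u" and v: "continuous_on {T..b} v"
    and zero: "\<And>g. continuous_on {a..b} g \<Longrightarrow>
       integral {a..T} (\<lambda>t. u t * g t) + integral {T..b} (\<lambda>t. v t * g t) = 0"
  shows "t \<in> {a..T} \<Longrightarrow> u t = 0" and "t \<in> {T..b} \<Longrightarrow> v t = 0"
proof -
  define g where "g t = (if t \<le> T then (T - t) * u t else (t - T) * v t)" for t
  have "continuous_on ({a..T} \<union> {T..b}) g"
    unfolding g_def using assms
    by (intro continuous_on_If) (auto intro!: continuous_intros)
  moreover have "{a..T} \<union> {T..b} = {a..b}" using assms by auto
  ultimately have cg: "continuous_on {a..b} g" by simp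
  let ?U = "\<lambda>t. (T - t) * (u t)\<^sup>2" and ?V = "\<lambda>t. (t - T) * (v t)\<^sup>2"
  have "integral {a..T} (\<lambda>t. u t * g t) = integral {a..T} ?U"
    by (rule integral_cong) (simp add: g_def power2_eq_square)
  moreover have "integral {T..b} (\<lambda>t. v t * g t) = integral {T..b} ?V"
    by (rule integral_cong) (auto simp add: g_def power2_eq_square)
  moreover have "integral {a..T} ?U \<ge> 0" "integral {T..b} ?V \<ge> 0"
    by (auto intro!: integral_nonneg integrable_continuous_real continuous_intros u v)
  ultimately have U0: "integral {a..T} ?U = 0" and V0: "integral {T..b} ?V = 0"
    using zero[OF cg] by auto
  have Uz: "?U t = 0" if "t \<in> {a..T}" for t
  proof -
    have "continuous_on {a..T} ?U" by (intro continuous_intros u)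
    then show ?thesis using integral_eq_0_iff[of a T ?U] U0 that assms(1) by simp
  qed
  have Vz: "?V t = 0" if "t \<in> {T..b}" for t
  proof -
    have "continuous_on {T..b} ?V" by (intro continuous_intros v)
    then show ?thesis using integral_eq_0_iff[of T b ?V] V0 that assms(2) by simp
  qed
  have clU: "closure {a..<T} = {a..T}" and clV: "closure {T<..b} = {T..b}"
    using assms by auto
  have Uz': "u t = 0" if "t \<in> {a..<T}" for t using Uz[of t] that by simp
  have Vz': "v t = 0" if "t \<in> {T<..b}" for t using Vz[of t] that by simp
  show "u t = 0" if "t \<in> {a..T}"
    using continuous_constant_on_closure[of "{a..<T}" u 0 t] Uz' u that unfolding clU by blast
  show "v t = 0" if "t \<in> {T..b}"
    using continuous_constant_on_closure[of "{T<..b}" v 0 t] Vz' v that unfolding clV by blast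
qed

text \<open>The choice of \<open>\<kappa>\<close> makes the two sides of \<open>T\<close> match.
  Order m contributes \<open>integral {T..b} (wp m) * H m T\<close> from the right, minus
  \<open>\<kappa> m * H m T\<close> from the left and, for m = 0, the given
  \<open>c * H 0 T\<close>. Nothing arises at \<open>a\<close>, where \<open>H m\<close> vanishes,
  or at \<open>b\<close>, where the constants are 0.\<close>

lemma variation_reduction:
  fixes H Pm Pp :: "nat \<Rightarrow> real \<Rightarrow> real" and a b T c :: real and p :: "real \<Rightarrow> real"
  defines "wp \<equiv> tails Pp (\<lambda>_. 0) b (\<lambda>_. 0)"
  defines "\<kappa> \<equiv> \<lambda>m. integral {T..b} (wp m) + (if m = 0 then c else 0)"
  defines "wm \<equiv> tails Pm \<kappa> T p"
  assumes "a < T" "T < b" and p: "continuous_on {a..T} p"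
    and Pm: "\<And>i. i \<in> {1..n} \<Longrightarrow> continuous_on {a..T} (Pm i)"
    and Pp: "\<And>i. i \<in> {1..n} \<Longrightarrow> continuous_on {T..b} (Pp i)"
    and H_cont: "\<And>m. m \<le> n \<Longrightarrow> continuous_on {a..b} (H m)"
    and H_deriv: "\<And>m t. m < n \<Longrightarrow> t \<in> {a..b} \<Longrightarrow> (H m has_real_derivative H (Suc m) t) (at t within {a..b})"
    and H_a: "\<And>m. m < n \<Longrightarrow> H m a = 0"
  shows "integral {a..T} (\<lambda>t. p t * H 0 t) + c * H 0 T
       + (\<Sum>i=1..n. integral {a..T} (\<lambda>t. Pm i t * H i t) + integral {T..b} (\<lambda>t. Pp i t * H i t))
     = integral {a..T} (\<lambda>t. wm n t * H n t) + integral {T..b} (\<lambda>t. wp n t * H n t)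
       + (if n = 0 then c * H n T else 0)"
proof -
  let ?rest = "\<lambda>m. \<Sum>i=Suc m..n. integral {a..T} (\<lambda>t. Pm i t * H i t) + integral {T..b} (\<lambda>t. Pp i t * H i t)"
  \<comment> \<open>\<open>\<Phi> m\<close> is the first variation with the orders up to m merged.
    It does not depend on m, and m = 0 and m = n give the two sides of the claim.\<close>
  define \<Phi> where "\<Phi> m = integral {a..T} (\<lambda>t. wm m t * H m t) + integral {T..b} (\<lambda>t. wp m t * H m t)
       + (if m = 0 then c * H m T else 0) + ?rest m" for m
  have sub: "{a..T} \<subseteq> {a..b}" "{T..b} \<subseteq> {a..b}" using assms(4,5) by auto
  have cm: "continuous_on {a..T} (wm m)" and cp: "continuous_on {T..b} (wp m)" if "m \<le> n" for m
    unfolding wm_def wp_def using that by (auto intro!: tails_continuous[where n = n] p Pm Pp)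
  have step: "\<Phi> (Suc m) = \<Phi> m" if m: "m < n" for m
  proof -
    have cHm: "continuous_on {a..T} (H (Suc m))" and cHp: "continuous_on {T..b} (H (Suc m))"
      using continuous_on_subset[OF H_cont] sub m by auto
    have cKm: "continuous_on {a..T} (\<lambda>t. \<kappa> m + integral {t..T} (wm m))"
      using DERIV_continuous_on[OF integral_has_real_derivative'[OF cm]] m by (auto intro!: continuous_intros)
    have cKp: "continuous_on {T..b} (\<lambda>t. integral {t..b} (wp m))"
      using DERIV_continuous_on[OF integral_has_real_derivative'[OF cp]] m by auto
    have "integral {a..T} (\<lambda>t. wm m t * H m t) = (\<kappa> m + integral {a..T} (wm m)) * H m a - \<kappa> m * H m T
       + integral {a..T} (\<lambda>t. (\<kappa> m + integral {t..T} (wm m)) * H (Suc m) t)"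
      using assms(4,5) m
      by (intro integration_by_parts_tail cm cHm DERIV_subset[OF H_deriv]) auto
    moreover have "integral {T..b} (\<lambda>t. wp m t * H m t) = (0 + integral {T..b} (wp m)) * H m T - 0 * H m b
       + integral {T..b} (\<lambda>t. (0 + integral {t..b} (wp m)) * H (Suc m) t)"
      using assms(4,5) m
      by (intro integration_by_parts_tail cp cHp DERIV_subset[OF H_deriv]) auto
    moreover have "integral {a..T} (\<lambda>t. wm (Suc m) t * H (Suc m) t)
       = integral {a..T} (\<lambda>t. Pm (Suc m) t * H (Suc m) t)
         + integral {a..T} (\<lambda>t. (\<kappa> m + integral {t..T} (wm m)) * H (Suc m) t)"
    proof -
      have "wm (Suc m) t * H (Suc m) t
          = Pm (Suc m) t * H (Suc m) t + (\<kappa> m + integral {t..T} (wm m)) * H (Suc m) t" for t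
        by (simp add: wm_def algebra_simps)
      moreover have "continuous_on {a..T} (Pm (Suc m))" using m by (intro Pm) auto
      ultimately show ?thesis using cHm cKm
        by (simp only:) (intro integral_add integrable_continuous_real continuous_on_mult)
    qed
    moreover have "integral {T..b} (\<lambda>t. wp (Suc m) t * H (Suc m) t)
       = integral {T..b} (\<lambda>t. Pp (Suc m) t * H (Suc m) t)
         + integral {T..b} (\<lambda>t. integral {t..b} (wp m) * H (Suc m) t)"
    proof -
      have "wp (Suc m) t * H (Suc m) t
          = Pp (Suc m) t * H (Suc m) t + integral {t..b} (wp m) * H (Suc m) t" for t
        by (simp add: wp_def algebra_simps)
      moreover have "continuous_on {T..b} (Pp (Suc m))" using m by (intro Pp) auto
      ultimately show ?thesis using cHp cKp
        by (simp only:) (intro integral_add integrable_continuous_real continuous_on_mult)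
    qed
    moreover have "?rest m = integral {a..T} (\<lambda>t. Pm (Suc m) t * H (Suc m) t)
         + integral {T..b} (\<lambda>t. Pp (Suc m) t * H (Suc m) t) + ?rest (Suc m)"
      using m by (subst sum.atLeast_Suc_atMost) auto
    ultimately show ?thesis
      using H_a[OF m] by (simp add: \<Phi>_def \<kappa>_def algebra_simps split: if_splits)
  qed
  have "\<Phi> m = \<Phi> 0" if "m \<le> n" for m
    using that step by (induction m) auto
  from this[of n] show ?thesis
    by (simp add: \<Phi>_def wm_def wp_def)
qed

text \<open>The top derivative g is arbitrary, so the merged coefficients of order \<open>n\<close>
  vanish on both sides. The two equations are then the case m = 0 of the recursion. At
  \<open>b\<close> the right tail integral is taken over a point, which gives the end condition. At
  \<open>T\<close> the left tail integral is taken over a point, leaving \<open>\<kappa> j\<close>,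
  that is, the right tail integral at \<open>T\<close> plus \<open>c\<close> if j = 0: this is the
  jump.\<close>

lemma variation_two_sided:
  fixes Pm Pp :: "nat \<Rightarrow> real \<Rightarrow> real"
  assumes "a < T" "T < b" "1 \<le> n" and p: "continuous_on {a..T} p"
    and Pm: "\<And>i. i \<in> {1..n} \<Longrightarrow> times_differentiable_on i (Pm i) {a..T}"
    and Pp: "\<And>i. i \<in> {1..n} \<Longrightarrow> times_differentiable_on i (Pp i) {T..b}"
    and var: "\<And>g. continuous_on {a..b} g \<Longrightarrow>
       integral {a..T} (\<lambda>t. p t * iterated_integral a g n t) + c * iterated_integral a g n T
       + (\<Sum>i=1..n. integral {a..T} (\<lambda>t. Pm i t * iterated_integral a g (n - i) t)
          + integral {T..b} (\<lambda>t. Pp i t * iterated_integral a g (n - i) t)) = 0"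
  shows variation_left: "\<And>t. t \<in> {a..T} \<Longrightarrow> p t + (\<Sum>i=1..n. (-1) ^ i * nderiv {a..T} i (Pm i) t) = 0"
    and variation_right: "\<And>t. t \<in> {T..b} \<Longrightarrow> (\<Sum>i=1..n. (-1) ^ i * nderiv {T..b} i (Pp i) t) = 0"
    and variation_end: "\<And>j. j < n \<Longrightarrow> (\<Sum>i=Suc j..n. (-1) ^ (i - j) * nderiv {T..b} (i - 1 - j) (Pp i) b) = 0"
    and variation_jump: "\<And>j. j < n \<Longrightarrow> (\<Sum>i=Suc j..n. (-1) ^ (i - j) * nderiv {a..T} (i - 1 - j) (Pm i) T)
         = (\<Sum>i=Suc j..n. (-1) ^ (i - j) * nderiv {T..b} (i - 1 - j) (Pp i) T) + (if j = 0 then c else 0)"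
proof -
  define wp where "wp = tails Pp (\<lambda>_. 0) b (\<lambda>_. 0)"
  define \<kappa> where "\<kappa> = (\<lambda>m. integral {T..b} (wp m) + (if m = 0 then c else 0))"
  define wm where "wm = tails Pm \<kappa> T p"
  have cP: "continuous_on {a..T} (Pm i)" "continuous_on {T..b} (Pp i)" if i: "i \<in> {1..n}" for i
    using nderiv_continuous_on[OF Pm[OF i], of 0] nderiv_continuous_on[OF Pp[OF i], of 0] i by auto
  have cm: "continuous_on {a..T} (wm n)" and cp: "continuous_on {T..b} (wp n)"
    unfolding wm_def wp_def by (auto intro!: tails_continuous[where n = n] p cP)
  have zero: "integral {a..T} (\<lambda>t. wm n t * g t) + integral {T..b} (\<lambda>t. wp n t * g t) = 0"
    if g: "continuous_on {a..b} g" for g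
  proof -
    let ?H = "\<lambda>m. iterated_integral a g (n - m)"
    have "?H m a = 0" if "m < n" for m
      using that by (cases "n - m") auto
    then have "integral {a..T} (\<lambda>t. p t * ?H 0 t) + c * ?H 0 T
       + (\<Sum>i=1..n. integral {a..T} (\<lambda>t. Pm i t * ?H i t) + integral {T..b} (\<lambda>t. Pp i t * ?H i t))
     = integral {a..T} (\<lambda>t. wm n t * ?H n t) + integral {T..b} (\<lambda>t. wp n t * ?H n t)
       + (if n = 0 then c * ?H n T else 0)"
      unfolding wm_def wp_def \<kappa>_def
      by (intro variation_reduction assms(1,2) p cP iterated_integral_continuous[OF g]
            iterated_integral_chain[OF g])
    then show ?thesis using var[OF g] assms(3) by simp
  qed
  have wm0: "wm n t = 0" if "t \<in> {a..T}" for t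
    using continuous_two_sided_vanish(1)[OF assms(1,2) cm cp zero that] .
  have wp0: "wp n t = 0" if "t \<in> {T..b}" for t
    using continuous_two_sided_vanish(2)[OF assms(1,2) cm cp zero that] .
  note m_deriv = tails_vanish_deriv[OF assms(1) p Pm wm0[unfolded wm_def]]
    and m_int = tails_vanish_integral[OF assms(1) p Pm wm0[unfolded wm_def]]
    and p_deriv = tails_vanish_deriv[OF assms(2) continuous_on_const Pp wp0[unfolded wp_def]]
    and p_int = tails_vanish_integral[OF assms(2) continuous_on_const Pp wp0[unfolded wp_def]]
  show "p t + (\<Sum>i=1..n. (-1) ^ i * nderiv {a..T} i (Pm i) t) = 0" if "t \<in> {a..T}" for t
    using m_deriv[of 0 t] that by simp
  show "(\<Sum>i=1..n. (-1) ^ i * nderiv {T..b} i (Pp i) t) = 0" if "t \<in> {T..b}" for t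
    using p_deriv[of 0 t] that by simp
  show "(\<Sum>i=Suc j..n. (-1) ^ (i - j) * nderiv {T..b} (i - 1 - j) (Pp i) b) = 0" if "j < n" for j
    using p_int[of j b] that assms(2) by simp
  show "(\<Sum>i=Suc j..n. (-1) ^ (i - j) * nderiv {a..T} (i - 1 - j) (Pm i) T)
      = (\<Sum>i=Suc j..n. (-1) ^ (i - j) * nderiv {T..b} (i - 1 - j) (Pp i) T) + (if j = 0 then c else 0)"
    if "j < n" for j
    using m_int[of j T] p_int[of j T] that assms(1,2) by (simp add: \<kappa>_def wp_def)
qed

section \<open>First variation of the Lagrangian\<close>

text \<open>One partial derivative at the point, together with a continuous other one, yields joint
  differentiability, and hence a chain rule along the graph of \<open>y\<close>. It serves the
  terminal cost along the curve, with \<open>S = {a..b}\<close>, and the release of one more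
  coordinate of \<open>L\<close>, with \<open>S = UNIV\<close>.\<close>

lemma DERIV_chain_partials:
  fixes f :: "real \<Rightarrow> real \<Rightarrow> real"
  assumes f1: "((\<lambda>s. f s (y x)) has_real_derivative A) (at x within S)"
    and f2: "\<And>s r. s \<in> S \<Longrightarrow> ((\<lambda>r. f s r) has_real_derivative B s r) (at r)"
    and B: "continuous_on (S \<times> UNIV) (\<lambda>(s, r). B s r)"
    and y: "(y has_real_derivative y') (at x within S)" and "x \<in> S"
  shows "((\<lambda>s. f s (y s)) has_real_derivative A + B x (y x) * y') (at x within S)"
proof -
  have "((\<lambda>(s, r). f s r) has_derivative (\<lambda>(tx, ty). (*) A tx + blinfun_apply (blinfun_mult_right (B x (y x))) ty))
      (at (x, y x) within S \<times> UNIV)"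
  proof (rule has_derivative_partialsI[where fy = "\<lambda>s r. blinfun_mult_right (B s r)"])
    show "((\<lambda>s. f s (y x)) has_derivative (*) A) (at x within S)"
      using f1 by (simp add: has_field_derivative_def)
    show "((\<lambda>r. f s r) has_derivative blinfun_apply (blinfun_mult_right (B s r))) (at r within UNIV)"
      if "s \<in> S" for s r
      using f2[OF that] by (simp add: has_field_derivative_eq_has_derivative_blinfun)
    have "continuous_on (S \<times> UNIV) (\<lambda>z. blinfun_mult_right (B (fst z) (snd z)))"
      using B by (intro bounded_linear.continuous_on[OF bounded_linear_blinfun_mult_right])
        (simp add: case_prod_beta')
    then show "continuous (at (x, y x) within S \<times> UNIV) (\<lambda>(s, r). blinfun_mult_right (B s r))"
      using \<open>x \<in> S\<close> by (simp add: continuous_on_eq_continuous_within case_prod_beta')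
  qed auto
  then have joint: "((\<lambda>(s, r). f s r) has_derivative
      (\<lambda>(tx, ty). A * tx + blinfun_apply (blinfun_mult_right (B x (y x))) ty))
      (at (x, y x) within (\<lambda>s. (s, y s)) ` S)"
    by (rule has_derivative_subset) auto
  have "((\<lambda>s. (s, y s)) has_derivative (\<lambda>t. (t, y' * t))) (at x within S)"
    using y by (auto intro!: derivative_eq_intros simp: has_field_derivative_def)
  from has_derivative_in_compose[OF this joint] show ?thesis
    unfolding has_field_derivative_def
    by (auto elim!: has_derivative_eq_rhs simp: fun_eq_iff algebra_simps)
qed

text \<open>Only the coordinates in \<open>K\<close> move, so that \<open>K\<close> can grow one
  element at a time. For \<open>K\<close> inside \<open>{2..n+2}\<close> the time and the default
  values outside the index set stay fixed.\<close>

definition shift :: "nat set \<Rightarrow> (nat \<Rightarrow> real) \<Rightarrow> (nat \<Rightarrow> real) \<Rightarrow> real \<Rightarrow> nat \<Rightarrow> real" where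
  "shift K u v \<epsilon> = (\<lambda>k. if k \<in> K then u k + \<epsilon> * v k else u k)"

lemma Ldom_update:
  assumes "u \<in> Ldom a b n" "k \<in> {2..n+2}"
  shows "u(k := z) \<in> Ldom a b n"
proof -
  have "u j \<in> slot a b j" if "j \<in> {1..n+2}" for j
    using assms(1) that by (auto simp: Ldom_def PiE_iff)
  moreover have "slot a b k = UNIV" using assms(2) by (simp add: slot_def)
  moreover have "u j = undefined" if "j \<notin> {1..n+2}" for j
    using assms(1) that by (auto simp: Ldom_def PiE_iff extensional_def)
  ultimately show ?thesis
    unfolding Ldom_def using assms(2) by (intro PiE_I) (simp_all only: fun_upd_apply, auto)
qed

lemma shift_Ldom:
  assumes "u \<in> Ldom a b n" "K \<subseteq> {2..n+2}"
  shows "shift K u v \<epsilon> \<in> Ldom a b n"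
proof -
  have "u j \<in> slot a b j" if "j \<in> {1..n+2}" for j
    using assms(1) that by (auto simp: Ldom_def PiE_iff)
  moreover have "slot a b j = UNIV" if "j \<in> K" for j using assms(2) that by (auto simp: slot_def)
  moreover have "u j = undefined" "j \<notin> K" if "j \<notin> {1..n+2}" for j
    using assms that by (auto simp: Ldom_def PiE_iff extensional_def)
  ultimately show ?thesis
    unfolding Ldom_def shift_def
    by (intro PiE_I) (metis (no_types, lifting) UNIV_I, metis (no_types, lifting))
qed

lemma C1_Lagrangian_partial:
  assumes "C1_Lagrangian a b n L" "u \<in> Ldom a b n" "k \<in> {2..n+2}"
  shows "((\<lambda>s. L (u(k := s))) has_real_derivative partial a b k L u) (at (u k))"
proof -
  have "k \<in> {1..n+2}" "slot a b k = UNIV" using assms(3) by (auto simp: slot_def)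
  moreover from this have "(\<lambda>s. L (u(k := s))) differentiable (at (u k) within slot a b k)"
    using assms(1,2) unfolding C1_Lagrangian_def by blast
  ultimately show ?thesis
    by (simp add: partial_def has_real_derivative_iff_has_vector_derivative vector_derivative_works)
qed

lemma C1_Lagrangian_continuous:
  assumes "C1_Lagrangian a b n L"
  shows "continuous_on (Ldom a b n) L"
  using assms unfolding C1_Lagrangian_def by blast

lemma C1_Lagrangian_partial_continuous:
  assumes "C1_Lagrangian a b n L" "k \<in> {1..n+2}"
  shows "continuous_on (Ldom a b n) (partial a b k L)"
  using assms unfolding C1_Lagrangian_def by blast

text \<open>\<open>C1_Lagrangian\<close> speaks of partial derivatives only, so the coordinates are
  released one by one. In \<open>w s r\<close> the old coordinates run with s and the new one with
  r, and the line is the diagonal s = r. The base point \<open>u\<close> is arbitrary in the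
  induction because its entry at \<open>k\<close> is already displaced when the hypothesis is
  applied.\<close>

lemma C1_Lagrangian_deriv_along:
  assumes L: "C1_Lagrangian a b n L" and "finite K" "K \<subseteq> {2..n+2}" "u \<in> Ldom a b n"
  shows "((\<lambda>\<epsilon>. L (shift K u v \<epsilon>)) has_real_derivative
           (\<Sum>k\<in>K. partial a b k L (shift K u v \<epsilon>) * v k)) (at \<epsilon>)"
  using \<open>finite K\<close> assms(3,4)
proof (induction K arbitrary: u rule: finite_induct)
  case empty
  then show ?case by (simp add: shift_def)
next
  case (insert k K)
  define w where "w s r = shift K (u(k := u k + r * v k)) v s" for s r
  have diag: "shift (insert k K) u v s = w s s" for s
    using insert.hyps by (auto simp: w_def shift_def fun_eq_iff)
  have k: "k \<in> {2..n+2}" and K: "K \<subseteq> {2..n+2}" using insert.prems by auto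
  have w_dom: "w s r \<in> Ldom a b n" for s r
    unfolding w_def by (intro shift_Ldom Ldom_update insert.prems K k)
  have "((\<lambda>s. L (w s s)) has_real_derivative
      (\<Sum>j\<in>K. partial a b j L (w \<epsilon> \<epsilon>) * v j) + partial a b k L (w \<epsilon> \<epsilon>) * v k * 1) (at \<epsilon> within UNIV)"
  proof (rule DERIV_chain_partials[where y = "\<lambda>s. s" and f = "\<lambda>s r. L (w s r)"
        and B = "\<lambda>s r. partial a b k L (w s r) * v k"])
    show "((\<lambda>s. L (w s \<epsilon>)) has_real_derivative (\<Sum>j\<in>K. partial a b j L (w \<epsilon> \<epsilon>) * v j)) (at \<epsilon>)"
      unfolding w_def by (rule insert.IH[OF K Ldom_update[OF insert.prems(2) k]])
    show "((\<lambda>r. L (w s r)) has_real_derivative partial a b k L (w s r) * v k) (at r)" for s r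
    proof -
      have "(w s r)(k := u k + r' * v k) = w s r'" for r'
        using insert.hyps by (auto simp: w_def shift_def fun_eq_iff)
      moreover have "w s r k = u k + r * v k"
        using insert.hyps by (simp add: w_def shift_def)
      moreover have "((\<lambda>r'. u k + r' * v k) has_real_derivative v k) (at r)"
        by (auto intro!: derivative_eq_intros)
      ultimately show ?thesis
        using DERIV_chain2[where f = "\<lambda>z. L ((w s r)(k := z))" and g = "\<lambda>r'. u k + r' * v k" and x = r and s = UNIV,
            of "partial a b k L (w s r)" "v k"] C1_Lagrangian_partial[OF L w_dom k, of s r] by simp
    qed
    have "continuous_on UNIV (\<lambda>z. w (fst z) (snd z))"
    proof (rule continuous_on_coordinatewise_then_product)
      show "continuous_on UNIV (\<lambda>z. w (fst z) (snd z) j)" for j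
        by (cases "j \<in> K"; cases "j = k") (auto simp: w_def shift_def intro!: continuous_intros)
    qed
    then have "continuous_on UNIV (\<lambda>z. partial a b k L (w (fst z) (snd z)))"
      by (rule continuous_on_compose2[OF C1_Lagrangian_partial_continuous[OF L], rotated])
        (use k w_dom in auto)
    then show "continuous_on (UNIV \<times> UNIV) (\<lambda>(s, r). partial a b k L (w s r) * v k)"
      by (auto simp: case_prod_beta' intro!: continuous_intros)
  qed auto
  then show ?case
    using insert.hyps by (simp add: diag algebra_simps)
qed

text \<open>Differentiation under the integral: the derivative of the integrand is jointly
  continuous in \<epsilon> and t, which in the product topology is checked coordinate by
  coordinate.\<close>

lemma C1_Lagrangian_first_variation:
  fixes c T :: real
  assumes L: "C1_Lagrangian a b n L"
    and U: "\<And>t. t \<in> {c..T} \<Longrightarrow> U t \<in> Ldom a b n" "continuous_on {c..T} U"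
    and V: "\<And>k. k \<in> {2..n+2} \<Longrightarrow> continuous_on {c..T} (\<lambda>t. V t k)"
  shows "((\<lambda>\<epsilon>. integral {c..T} (\<lambda>t. L (shift {2..n+2} (U t) (V t) \<epsilon>))) has_real_derivative
           integral {c..T} (\<lambda>t. \<Sum>k=2..n+2. partial a b k L (U t) * V t k)) (at 0)"
proof -
  let ?s = "\<lambda>\<epsilon> t. shift {2..n+2} (U t) (V t) \<epsilon>"
  have Uk: "continuous_on {c..T} (\<lambda>t. U t k)" for k
    using continuous_on_product_then_coordinatewise[OF U(2)] .
  have cs: "continuous_on (UNIV \<times> {c..T}) (\<lambda>z. ?s (fst z) (snd z))"
  proof (rule continuous_on_coordinatewise_then_product)
    fix k
    have "continuous_on (UNIV \<times> {c..T}) (\<lambda>z. U (snd z) k)"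
      by (rule continuous_on_compose2[OF Uk]) (auto intro!: continuous_intros)
    moreover have "continuous_on (UNIV \<times> {c..T}) (\<lambda>z. V (snd z) k)" if "k \<in> {2..n+2}"
      by (rule continuous_on_compose2[OF V[OF that]]) (auto intro!: continuous_intros)
    ultimately show "continuous_on (UNIV \<times> {c..T}) (\<lambda>z. ?s (fst z) (snd z) k)"
      by (cases "k \<in> {2..n+2}") (auto simp: shift_def intro!: continuous_intros)
  qed
  have s_dom: "?s \<epsilon> t \<in> Ldom a b n" if "t \<in> {c..T}" for \<epsilon> t
    using shift_Ldom[OF U(1)[OF that]] by simp
  have "((\<lambda>\<epsilon>. integral (cbox c T) (\<lambda>t. L (?s \<epsilon> t))) has_real_derivative
      integral (cbox c T) (\<lambda>t. \<Sum>k=2..n+2. partial a b k L (?s 0 t) * V t k)) (at 0 within UNIV)"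
  proof (rule leibniz_rule_field_derivative[where fx = "\<lambda>\<epsilon> t. \<Sum>k=2..n+2. partial a b k L (?s \<epsilon> t) * V t k"])
    show "((\<lambda>\<epsilon>. L (?s \<epsilon> t)) has_real_derivative (\<Sum>k=2..n+2. partial a b k L (?s \<epsilon> t) * V t k)) (at \<epsilon>)"
      if "t \<in> cbox c T" for \<epsilon> t
      by (rule C1_Lagrangian_deriv_along[OF L _ _ U(1)]) (use that in auto)
    have "continuous_on {c..T} (\<lambda>t. ?s \<epsilon> t)" for \<epsilon>
    proof -
      have "continuous_on {c..T} (\<lambda>t. ?s (fst (\<epsilon>, t)) (snd (\<epsilon>, t)))"
        by (rule continuous_on_compose2[OF cs]) (auto intro!: continuous_on_Pair)
      then show ?thesis by simp
    qed
    then have "continuous_on {c..T} (\<lambda>t. L (?s \<epsilon> t))" for \<epsilon>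
      by (rule continuous_on_compose2[OF C1_Lagrangian_continuous[OF L]]) (use s_dom in auto)
    then show "(\<lambda>t. L (?s \<epsilon> t)) integrable_on cbox c T" for \<epsilon>
      by (auto intro!: integrable_continuous_real)
    have "continuous_on (UNIV \<times> {c..T}) (\<lambda>z. \<Sum>k=2..n+2. partial a b k L (?s (fst z) (snd z)) * V (snd z) k)"
    proof (intro continuous_on_sum continuous_on_mult)
      fix k assume k: "k \<in> {2..n+2}"
      show "continuous_on (UNIV \<times> {c..T}) (\<lambda>z. partial a b k L (?s (fst z) (snd z)))"
        by (rule continuous_on_compose2[OF C1_Lagrangian_partial_continuous[OF L] cs])
          (use k s_dom in auto)
      show "continuous_on (UNIV \<times> {c..T}) (\<lambda>z. V (snd z) k)"
        by (rule continuous_on_compose2[OF V[OF k]]) (auto intro!: continuous_intros)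
    qed
    then show "continuous_on (UNIV \<times> cbox c T) (\<lambda>(\<epsilon>, t). \<Sum>k=2..n+2. partial a b k L (?s \<epsilon> t) * V t k)"
      by (simp add: case_prod_beta')
  qed auto
  moreover have "?s 0 t = U t" for t by (simp add: shift_def fun_eq_iff)
  ultimately show ?thesis by (simp only: interval_cbox)
qed

section \<open>Stationarity conditions\<close>

text \<open>The Caputo derivatives of a C^n function are weakly singular integrals of continuous
  functions. Hence a perturbed curve remains in \<open>Dset\<close> as soon as it is C^n.\<close>

lemma C_on_Dset:
  assumes "\<And>i. i \<in> {1..n} \<Longrightarrow> variable_order a b i (\<alpha> i)"
    and "\<And>i. i \<in> {1..n} \<Longrightarrow> variable_order a b i (\<beta> i)"
    and y: "y \<in> C_on n {a..b}" and "t \<in> {a..b}"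
  shows "(y, t) \<in> Dset a b n \<alpha> \<beta> \<gamma>"
proof -
  have "combined_Caputo_exists a b i (\<alpha> i) (\<beta> i) y \<and>
      continuous_on {a..b} (combined_Caputo a b i (\<alpha> i) (\<beta> i) (\<gamma> i) y)" if i: "i \<in> {1..n}" for i
  proof -
    have c: "continuous_on {a..b} (nderiv {a..b} i y)"
      using C_on_nderiv_continuous[OF y] i by auto
    interpret \<alpha>: variable_order a b i "\<alpha> i" by (rule assms(1)[OF i])
    interpret \<beta>: variable_order a b i "\<beta> i" by (rule assms(2)[OF i])
    have "combined_Caputo_exists a b i (\<alpha> i) (\<beta> i) y"
      unfolding combined_Caputo_exists_def using \<alpha>.left_integrable[OF c] \<beta>.right_integrable[OF c] by blast
    moreover have "continuous_on {a..b} (combined_Caputo a b i (\<alpha> i) (\<beta> i) (\<gamma> i) y)"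
      unfolding combined_Caputo_def[abs_def] left_Caputo_def right_Caputo_def
      by (intro continuous_intros \<alpha>.left_int_continuous \<beta>.right_int_continuous c)
    ultimately show ?thesis ..
  qed
  then show ?thesis using assms(3,4) by (simp add: Dset_def)
qed

lemma combined_Caputo_lincomb:
  assumes "a < b" "variable_order a b i A" "variable_order a b i B"
    and x: "x \<in> C_on n {a..b}" and h: "h \<in> C_on n {a..b}" and "i \<le> n" and t: "t \<in> {a..b}"
  shows "combined_Caputo a b i A B g (\<lambda>s. x s + \<epsilon> * h s) t
       = combined_Caputo a b i A B g x t + \<epsilon> * combined_Caputo a b i A B g h t"
proof -
  interpret A: variable_order a b i A by fact
  interpret B: variable_order a b i B by fact
  let ?D = "nderiv {a..b} i"
  have cx: "continuous_on {a..b} (?D x)" and ch: "continuous_on {a..b} (?D h)"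
    using C_on_nderiv_continuous x h \<open>i \<le> n\<close> by blast+
  have eq: "?D (\<lambda>s. x s + \<epsilon> * h s) r = ?D x r + \<epsilon> * ?D h r" if "r \<in> {a..b}" for r
    by (rule nderiv_C_on_lincomb) fact+
  have "left_int i A a (?D (\<lambda>s. x s + \<epsilon> * h s)) t = left_int i A a (?D x) t + \<epsilon> * left_int i A a (?D h) t"
  proof -
    have "((\<lambda>r. fkernel i A t r * ?D x r + \<epsilon> * (fkernel i A t r * ?D h r)) has_integral
        left_int i A a (?D x) t + \<epsilon> * left_int i A a (?D h) t) {a..t}"
      unfolding left_int_def
      by (intro has_integral_add has_integral_mult_right integrable_integral A.left_integrable cx ch t)
    then have "((\<lambda>r. fkernel i A t r * ?D (\<lambda>s. x s + \<epsilon> * h s) r) has_integral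
        left_int i A a (?D x) t + \<epsilon> * left_int i A a (?D h) t) {a..t}"
      by (rule has_integral_eq[rotated]) (use t eq in \<open>simp add: algebra_simps\<close>)
    then show ?thesis unfolding left_int_def by (rule integral_unique)
  qed
  moreover have "right_int i B b (?D (\<lambda>s. x s + \<epsilon> * h s)) t = right_int i B b (?D x) t + \<epsilon> * right_int i B b (?D h) t"
  proof -
    have "((\<lambda>r. fkernel i B r t * ?D x r + \<epsilon> * (fkernel i B r t * ?D h r)) has_integral
        right_int i B b (?D x) t + \<epsilon> * right_int i B b (?D h) t) {t..b}"
      unfolding right_int_def
      by (intro has_integral_add has_integral_mult_right integrable_integral B.right_integrable cx ch t)
    then have "((\<lambda>r. fkernel i B r t * ?D (\<lambda>s. x s + \<epsilon> * h s) r) has_integral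
        right_int i B b (?D x) t + \<epsilon> * right_int i B b (?D h) t) {t..b}"
      by (rule has_integral_eq[rotated]) (use t eq in \<open>simp add: algebra_simps\<close>)
    then show ?thesis unfolding right_int_def by (rule integral_unique)
  qed
  ultimately show ?thesis
    by (simp add: combined_Caputo_def left_Caputo_def right_Caputo_def algebra_simps)
qed

lemma jet_Ldom:
  assumes "t \<in> {a..b}"
  shows "jet a b n \<alpha> \<beta> \<gamma> x t \<in> Ldom a b n"
  using assms by (auto simp: jet_def Ldom_def slot_def)

lemma jet_continuous:
  assumes x: "(x, T) \<in> Dset a b n \<alpha> \<beta> \<gamma>"
  shows "continuous_on {a..b} (jet a b n \<alpha> \<beta> \<gamma> x)"
proof (rule continuous_on_coordinatewise_then_product)
  fix k
  have "continuous_on {a..b} x"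
    using x C_on_nderiv_continuous[of x n "{a..b}" 0] by (auto simp: Dset_def)
  moreover have "continuous_on {a..b} (combined_Caputo a b (k - 2) (\<alpha> (k - 2)) (\<beta> (k - 2)) (\<gamma> (k - 2)) x)"
    if "k \<in> {1..n+2}" "k \<noteq> 1" "k \<noteq> 2"
  proof -
    have "k - 2 \<in> {1..n}" using that by auto
    then show ?thesis using x by (auto simp: Dset_def)
  qed
  moreover have "jet a b n \<alpha> \<beta> \<gamma> x t k = undefined" if "k \<notin> {1..n+2}" for t
    using that by (simp add: jet_def restrict_def del: atLeastAtMost_iff)
  ultimately show "continuous_on {a..b} (\<lambda>t. jet a b n \<alpha> \<beta> \<gamma> x t k)"
    by (cases "k \<in> {1..n+2}"; cases "k = 1"; cases "k = 2")
      (simp_all add: jet_def del: atLeastAtMost_iff)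
qed

text \<open>By linearity of the Caputo derivatives the jet moves along a straight line; slot 1, the
  time, is excluded from the moving set.\<close>

lemma jet_lincomb:
  assumes "a < b"
    and \<alpha>: "\<And>i. i \<in> {1..n} \<Longrightarrow> variable_order a b i (\<alpha> i)"
    and \<beta>: "\<And>i. i \<in> {1..n} \<Longrightarrow> variable_order a b i (\<beta> i)"
    and "x \<in> C_on n {a..b}" "h \<in> C_on n {a..b}" "t \<in> {a..b}"
  shows "jet a b n \<alpha> \<beta> \<gamma> (\<lambda>s. x s + \<epsilon> * h s) t
       = shift {2..n+2} (jet a b n \<alpha> \<beta> \<gamma> x t) (jet a b n \<alpha> \<beta> \<gamma> h t) \<epsilon>"
proof
  fix k
  consider "k \<notin> {1..n+2}" | "k = 1" | "k = 2" | i where "k = i + 2" "i \<in> {1..n}"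
  proof -
    have "k = (k - 2) + 2" "k - 2 \<in> {1..n}" if "k \<in> {1..n+2}" "k \<noteq> 1" "k \<noteq> 2" using that by auto
    then show thesis using that by blast
  qed
  then show "jet a b n \<alpha> \<beta> \<gamma> (\<lambda>s. x s + \<epsilon> * h s) t k
      = shift {2..n+2} (jet a b n \<alpha> \<beta> \<gamma> x t) (jet a b n \<alpha> \<beta> \<gamma> h t) \<epsilon> k"
  proof cases
    case (4 i)
    then have "combined_Caputo a b i (\<alpha> i) (\<beta> i) (\<gamma> i) (\<lambda>s. x s + \<epsilon> * h s) t
       = combined_Caputo a b i (\<alpha> i) (\<beta> i) (\<gamma> i) x t + \<epsilon> * combined_Caputo a b i (\<alpha> i) (\<beta> i) (\<gamma> i) h t"
      using assms by (intro combined_Caputo_lincomb[OF \<open>a < b\<close> \<alpha> \<beta>]) auto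
    then show ?thesis using 4 by (simp add: jet_def shift_def)
  qed (auto simp: jet_def shift_def)
qed

text \<open>Minimality is local, so small multiples of \<open>h\<close> must be small in the norm.
  \<open>B\<close> is the sum of the two maxima for \<open>h\<close>.\<close>

lemma Dnorm_scale_bound:
  assumes "a < b"
    and \<alpha>: "\<And>i. i \<in> {1..n} \<Longrightarrow> variable_order a b i (\<alpha> i)"
    and \<beta>: "\<And>i. i \<in> {1..n} \<Longrightarrow> variable_order a b i (\<beta> i)"
    and h: "h \<in> C_on n {a..b}"
  obtains B where "\<And>\<epsilon> t. Dnorm a b n \<alpha> \<beta> \<gamma> (\<lambda>s. \<epsilon> * h s) t \<le> \<bar>\<epsilon>\<bar> * B + \<bar>t\<bar>"
proof -
  let ?c = "\<lambda>i h. combined_Caputo a b i (\<alpha> i) (\<beta> i) (\<gamma> i) h"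
  let ?S = "\<lambda>h s. \<Sum>i=1..n. \<bar>?c i h s\<bar>"
  have D: "(h, a) \<in> Dset a b n \<alpha> \<beta> \<gamma>"
    using C_on_Dset[OF \<alpha> \<beta> h, of a] \<open>a < b\<close> by simp
  have "continuous_on {a..b} h"
    using C_on_nderiv_continuous[OF h, of 0] by simp
  then have "continuous_on {a..b} (\<lambda>s. \<bar>h s\<bar>)" by (rule continuous_on_rabs)
  then obtain s1 where s1: "\<And>s. s \<in> {a..b} \<Longrightarrow> \<bar>h s\<bar> \<le> \<bar>h s1\<bar>"
    using continuous_attains_sup[of "{a..b}" "\<lambda>s. \<bar>h s\<bar>"] \<open>a < b\<close> by force
  have "continuous_on {a..b} (?S h)"
    using D by (intro continuous_intros) (auto simp: Dset_def)
  then obtain s2 where s2: "\<And>s. s \<in> {a..b} \<Longrightarrow> ?S h s \<le> ?S h s2"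
    using continuous_attains_sup[of "{a..b}" "?S h"] \<open>a < b\<close> by force
  have scale: "?c i (\<lambda>s. \<epsilon> * h s) s = \<epsilon> * ?c i h s" if "i \<in> {1..n}" "s \<in> {a..b}" for i s \<epsilon>
  proof -
    \<comment> \<open>Homogeneity is obtained from the linear combination rule by writing \<epsilon>
      h as h + (\<epsilon> - 1) h.\<close>
    have x: "(\<lambda>s. h s + (\<epsilon> - 1) * h s) = (\<lambda>s. \<epsilon> * h s)" by (auto simp: algebra_simps)
    have "?c i (\<lambda>s. h s + (\<epsilon> - 1) * h s) s = ?c i h s + (\<epsilon> - 1) * ?c i h s"
      using that h by (intro combined_Caputo_lincomb[OF \<open>a < b\<close> \<alpha> \<beta>]) auto
    then show ?thesis unfolding x by (simp add: algebra_simps)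
  qed
  have "Dnorm a b n \<alpha> \<beta> \<gamma> (\<lambda>s. \<epsilon> * h s) t \<le> \<bar>\<epsilon>\<bar> * (\<bar>h s1\<bar> + ?S h s2) + \<bar>t\<bar>" for \<epsilon> t
  proof -
    have "(SUP s\<in>{a..b}. \<bar>\<epsilon> * h s\<bar>) \<le> \<bar>\<epsilon>\<bar> * \<bar>h s1\<bar>"
      using \<open>a < b\<close> s1 by (intro cSUP_least) (auto simp: abs_mult intro!: mult_left_mono)
    moreover have "(SUP s\<in>{a..b}. ?S (\<lambda>s. \<epsilon> * h s) s) \<le> \<bar>\<epsilon>\<bar> * ?S h s2"
    proof (rule cSUP_least)
      fix s assume s: "s \<in> {a..b}"
      have "?S (\<lambda>s. \<epsilon> * h s) s = \<bar>\<epsilon>\<bar> * ?S h s"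
        unfolding sum_distrib_left by (intro sum.cong refl) (simp only: scale s abs_mult)
      also have "\<dots> \<le> \<bar>\<epsilon>\<bar> * ?S h s2" using s2[OF s] by (intro mult_left_mono) auto
      finally show "?S (\<lambda>s. \<epsilon> * h s) s \<le> \<bar>\<epsilon>\<bar> * ?S h s2" .
    qed (use \<open>a < b\<close> in auto)
    ultimately show ?thesis by (simp add: Dnorm_def algebra_simps)
  qed
  then show thesis by (rule that)
qed

lemma C1_terminal_partials:
  assumes "C1_terminal a b \<phi>" "t \<in> {a..b}"
  shows "((\<lambda>s. \<phi> s y) has_real_derivative partial1 a b \<phi> t y) (at t within {a..b})"
    and "((\<lambda>s. \<phi> t s) has_real_derivative partial2 \<phi> t y) (at y)"
proof -
  have "(\<lambda>s. \<phi> s y) differentiable (at t within {a..b})" "(\<lambda>s. \<phi> t s) differentiable (at y)"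
    using assms unfolding C1_terminal_def by blast+
  then show "((\<lambda>s. \<phi> s y) has_real_derivative partial1 a b \<phi> t y) (at t within {a..b})"
    "((\<lambda>s. \<phi> t s) has_real_derivative partial2 \<phi> t y) (at y)"
    unfolding partial1_def partial2_def has_real_derivative_iff_has_vector_derivative
    by (simp_all add: vector_derivative_works)
qed

text \<open>The curve is kept and only the end time moves, so the initial data persist. As
  \<open>T\<close> is interior, the derivative within \<open>{a..b}\<close> is an ordinary one and
  vanishes at a local minimum.\<close>

lemma minimizer_transversality_time:
  assumes ab: "a < b" and n: "1 \<le> n"
    and \<alpha>: "\<And>i. i \<in> {1..n} \<Longrightarrow> variable_order a b i (\<alpha> i)"
    and \<beta>: "\<And>i. i \<in> {1..n} \<Longrightarrow> variable_order a b i (\<beta> i)"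
    and L: "C1_Lagrangian a b n L" and \<phi>: "C1_terminal a b \<phi>"
    and min: "minimizer a b n \<alpha> \<beta> \<gamma> L \<phi> xa xad x T" and T: "a < T" "T < b"
  shows "L (jet a b n \<alpha> \<beta> \<gamma> x T) + (partial1 a b \<phi> T (x T) + partial2 \<phi> T (x T) * nderiv {a..b} 1 x T) = 0"
proof -
  let ?J = "functional_J a b n \<alpha> \<beta> \<gamma> L \<phi> x" and ?j = "jet a b n \<alpha> \<beta> \<gamma> x"
  have adm: "(x, T) \<in> admissible a b n \<alpha> \<beta> \<gamma> xa xad"
    using min by (simp add: minimizer_def)
  then have D: "(x, T) \<in> Dset a b n \<alpha> \<beta> \<gamma>" and x: "x \<in> C_on n {a..b}"
    by (auto simp: admissible_def Dset_def)
  have T_in: "T \<in> {a..b}" and T_int: "T \<in> interior {a..b}" using T by auto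
  obtain \<epsilon> where \<epsilon>: "\<epsilon> > 0" and le: "\<And>y S. (y, S) \<in> admissible a b n \<alpha> \<beta> \<gamma> xa xad \<Longrightarrow>
      Dnorm a b n \<alpha> \<beta> \<gamma> (\<lambda>s. y s - x s) (S - T) < \<epsilon> \<Longrightarrow> ?J T \<le> functional_J a b n \<alpha> \<beta> \<gamma> L \<phi> y S"
    using min unfolding minimizer_def by blast
  obtain B where B: "\<And>\<epsilon> t. Dnorm a b n \<alpha> \<beta> \<gamma> (\<lambda>s. \<epsilon> * x s) t \<le> \<bar>\<epsilon>\<bar> * B + \<bar>t\<bar>"
    using Dnorm_scale_bound[OF ab \<alpha> \<beta> x, where \<gamma> = \<gamma>] by blast
  have "continuous_on {a..b} (\<lambda>t. L (?j t))"
    by (rule continuous_on_compose2[OF C1_Lagrangian_continuous[OF L] jet_continuous[OF D]])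
      (auto intro: jet_Ldom)
  from integral_has_real_derivative[OF this T_in]
  have "((\<lambda>S. integral {a..S} (\<lambda>t. L (?j t))) has_real_derivative L (?j T)) (at T within {a..b})" .
  moreover have "((\<lambda>S. \<phi> S (x S)) has_real_derivative
      partial1 a b \<phi> T (x T) + partial2 \<phi> T (x T) * nderiv {a..b} 1 x T) (at T within {a..b})"
  proof (rule DERIV_chain_partials[OF C1_terminal_partials[OF \<phi>] _ _ T_in])
    show "continuous_on ({a..b} \<times> UNIV) (\<lambda>(s, r). partial2 \<phi> s r)"
      using \<phi> by (simp add: C1_terminal_def)
    show "(x has_real_derivative nderiv {a..b} 1 x T) (at T within {a..b})"
      using nderiv_has_real_derivative[of n x "{a..b}" 0 T] x n T_in by (simp add: C_on_def)
  qed (use T_in in auto)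
  ultimately have "(?J has_real_derivative
      L (?j T) + (partial1 a b \<phi> T (x T) + partial2 \<phi> T (x T) * nderiv {a..b} 1 x T)) (at T within {a..b})"
    unfolding functional_J_def[abs_def] by (rule DERIV_add)
  then have deriv: "(?J has_real_derivative
      L (?j T) + (partial1 a b \<phi> T (x T) + partial2 \<phi> T (x T) * nderiv {a..b} 1 x T)) (at T)"
    by (simp only: at_within_interior[OF T_int])
  show ?thesis
  proof (rule DERIV_local_min[OF deriv])
    show "0 < Min {\<epsilon>, T - a, b - T}" using \<epsilon> T by simp
    show "\<forall>S. \<bar>T - S\<bar> < Min {\<epsilon>, T - a, b - T} \<longrightarrow> ?J T \<le> ?J S"
    proof (intro allI impI)
      fix S assume "\<bar>T - S\<bar> < Min {\<epsilon>, T - a, b - T}"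
      then have S: "\<bar>S - T\<bar> < \<epsilon>" "S \<in> {a..b}" by auto
      then have "(x, S) \<in> admissible a b n \<alpha> \<beta> \<gamma> xa xad"
        using adm by (auto simp: admissible_def Dset_def)
      \<comment> \<open>With factor 0 the bound says that the pair (0, S - T) has norm at most |S -
        T|.\<close>
      then show "?J T \<le> ?J S"
        using B[of 0 "S - T"] S by (intro le) auto
    qed
  qed
qed

text \<open>The end time is kept. The conditions on \<open>h\<close> at \<open>a\<close> preserve
  the initial data, so small \<epsilon> of either sign gives a competitor and the derivative at 0
  vanishes.\<close>

lemma minimizer_first_variation:
  assumes ab: "a < b" and n: "1 \<le> n"
    and \<alpha>: "\<And>i. i \<in> {1..n} \<Longrightarrow> variable_order a b i (\<alpha> i)"
    and \<beta>: "\<And>i. i \<in> {1..n} \<Longrightarrow> variable_order a b i (\<beta> i)"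
    and L: "C1_Lagrangian a b n L" and \<phi>: "C1_terminal a b \<phi>"
    and min: "minimizer a b n \<alpha> \<beta> \<gamma> L \<phi> xa xad x T"
    and h: "h \<in> C_on n {a..b}" and h_a: "\<And>m. m < n \<Longrightarrow> nderiv {a..b} m h a = 0"
  shows "integral {a..T} (\<lambda>t. \<Sum>k=2..n+2. partial_along a b n \<alpha> \<beta> \<gamma> L x k t * jet a b n \<alpha> \<beta> \<gamma> h t k)
      + partial2 \<phi> T (x T) * h T = 0"
proof -
  let ?J = "functional_J a b n \<alpha> \<beta> \<gamma> L \<phi>" and ?j = "jet a b n \<alpha> \<beta> \<gamma>"
  have adm: "(x, T) \<in> admissible a b n \<alpha> \<beta> \<gamma> xa xad"
    using min by (simp add: minimizer_def)
  then have D: "(x, T) \<in> Dset a b n \<alpha> \<beta> \<gamma>" and x: "x \<in> C_on n {a..b}" and T: "T \<in> {a..b}"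
    by (auto simp: admissible_def Dset_def)
  have Dh: "(h, T) \<in> Dset a b n \<alpha> \<beta> \<gamma>" by (rule C_on_Dset[OF \<alpha> \<beta> h T])
  obtain \<epsilon>\<^sub>0 where \<epsilon>\<^sub>0: "\<epsilon>\<^sub>0 > 0" and le: "\<And>y S. (y, S) \<in> admissible a b n \<alpha> \<beta> \<gamma> xa xad \<Longrightarrow>
      Dnorm a b n \<alpha> \<beta> \<gamma> (\<lambda>s. y s - x s) (S - T) < \<epsilon>\<^sub>0 \<Longrightarrow> ?J x T \<le> ?J y S"
    using min unfolding minimizer_def by blast
  obtain B where B: "\<And>\<epsilon> t. Dnorm a b n \<alpha> \<beta> \<gamma> (\<lambda>s. \<epsilon> * h s) t \<le> \<bar>\<epsilon>\<bar> * B + \<bar>t\<bar>"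
    using Dnorm_scale_bound[OF ab \<alpha> \<beta> h, where \<gamma> = \<gamma>] by blast
  define F where "F \<epsilon> = ?J (\<lambda>s. x s + \<epsilon> * h s) T" for \<epsilon>
  have F: "F \<epsilon> = integral {a..T} (\<lambda>t. L (shift {2..n+2} (?j x t) (?j h t) \<epsilon>)) + \<phi> T (x T + \<epsilon> * h T)" for \<epsilon>
  proof -
    have "integral {a..T} (\<lambda>t. L (?j (\<lambda>s. x s + \<epsilon> * h s) t))
        = integral {a..T} (\<lambda>t. L (shift {2..n+2} (?j x t) (?j h t) \<epsilon>))"
      using T by (intro integral_cong arg_cong[where f = L] jet_lincomb[OF ab \<alpha> \<beta> x h]) auto
    then show ?thesis by (simp add: F_def functional_J_def)
  qed
  have sub: "{a..T} \<subseteq> {a..b}" using T by auto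
  have "((\<lambda>\<epsilon>. integral {a..T} (\<lambda>t. L (shift {2..n+2} (?j x t) (?j h t) \<epsilon>))) has_real_derivative
      integral {a..T} (\<lambda>t. \<Sum>k=2..n+2. partial a b k L (?j x t) * ?j h t k)) (at 0)"
  proof (rule C1_Lagrangian_first_variation[OF L])
    show "?j x t \<in> Ldom a b n" if "t \<in> {a..T}" for t using that T by (intro jet_Ldom) auto
    show "continuous_on {a..T} (?j x)" by (rule continuous_on_subset[OF jet_continuous[OF D] sub])
    show "continuous_on {a..T} (\<lambda>t. ?j h t k)" for k
      by (rule continuous_on_product_then_coordinatewise)
        (rule continuous_on_subset[OF jet_continuous[OF Dh] sub])
  qed
  moreover have "((\<lambda>\<epsilon>. \<phi> T (x T + \<epsilon> * h T)) has_real_derivative partial2 \<phi> T (x T) * h T) (at 0)"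
  proof (rule DERIV_chain2[where f = "\<phi> T" and g = "\<lambda>\<epsilon>. x T + \<epsilon> * h T"])
    show "(\<phi> T has_real_derivative partial2 \<phi> T (x T)) (at (x T + 0 * h T))"
      using C1_terminal_partials(2)[OF \<phi> T, of "x T"] by simp
  qed (auto intro!: derivative_eq_intros)
  ultimately have deriv: "(F has_real_derivative
      integral {a..T} (\<lambda>t. \<Sum>k=2..n+2. partial_along a b n \<alpha> \<beta> \<gamma> L x k t * ?j h t k)
      + partial2 \<phi> T (x T) * h T) (at 0)"
    unfolding F[abs_def] partial_along_def by (rule DERIV_add)
  show ?thesis
  proof (rule DERIV_local_min[OF deriv])
    \<comment> \<open>This radius forces |\<epsilon>| B below \<open>\<epsilon>\<^sub>0\<close>; the
      summand 1 excludes division by 0.\<close>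
    show "0 < \<epsilon>\<^sub>0 / (\<bar>B\<bar> + 1)" using \<epsilon>\<^sub>0 by simp
    show "\<forall>\<epsilon>. \<bar>0 - \<epsilon>\<bar> < \<epsilon>\<^sub>0 / (\<bar>B\<bar> + 1) \<longrightarrow> F 0 \<le> F \<epsilon>"
    proof (intro allI impI)
      fix \<epsilon> assume "\<bar>0 - \<epsilon>\<bar> < \<epsilon>\<^sub>0 / (\<bar>B\<bar> + 1)"
      then have small: "\<bar>\<epsilon>\<bar> * (\<bar>B\<bar> + 1) < \<epsilon>\<^sub>0" by (simp add: pos_less_divide_eq)
      let ?y = "\<lambda>s. x s + \<epsilon> * h s"
      have d: "nderiv {a..b} m ?y a = nderiv {a..b} m x a" if "m < n" for m
        using nderiv_C_on_lincomb[OF ab x h, of m a \<epsilon>] that h_a ab by simp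
      have "nderiv {a..b} m ?y a = xad m" if "m \<in> {1..n-1}" for m
        using d[of m] adm that n by (auto simp: admissible_def)
      moreover have "?y a = xa"
        using d[of 0] adm n by (simp add: admissible_def)
      ultimately have "(?y, T) \<in> admissible a b n \<alpha> \<beta> \<gamma> xa xad"
        using C_on_Dset[OF \<alpha> \<beta> C_on_lincomb[OF ab x h] T] by (simp add: admissible_def)
      moreover have "Dnorm a b n \<alpha> \<beta> \<gamma> (\<lambda>s. ?y s - x s) (T - T) < \<epsilon>\<^sub>0"
      proof -
        have "\<bar>\<epsilon>\<bar> * B \<le> \<bar>\<epsilon>\<bar> * (\<bar>B\<bar> + 1)" by (intro mult_left_mono) auto
        then show ?thesis using B[of \<epsilon> "T - T"] small by simp
      qed
      ultimately have "?J x T \<le> ?J ?y T" by (rule le)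
      then show "F 0 \<le> F \<epsilon>" by (simp add: F_def)
    qed
  qed
qed

text \<open>The left integral sees only \<open>{a..T}\<close> and turns into the right integral
  based at \<open>T\<close>; the right integral based at \<open>b\<close> leaves
  \<open>{a..T}\<close> and produces the second term. In the application \<open>v\<close> is the
  i-th derivative of the variation, and the sign of the right Caputo derivative is part of
  \<open>q\<close>.\<close>

lemma combined_integration_by_parts:
  assumes A: "variable_order a b i A" and B: "variable_order a b i B" and T: "a \<le> T" "T \<le> b"
    and u: "continuous_on {a..b} u" and v: "continuous_on {a..b} v"
  shows "integral {a..T} (\<lambda>t. u t * (p * left_int i A a v t + q * right_int i B b v t))
     = integral {a..T} (\<lambda>t. (p * right_int i A T u t + q * left_int i B a u t) * v t)
       + integral {T..b} (\<lambda>t. (q * left_int i B a u t + (- q) * left_int i B T u t) * v t)"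
proof -
  interpret A: variable_order a b i A by fact
  interpret B: variable_order a b i B by fact
  interpret AT: variable_order a T i A using T by (intro A.subinterval) auto
  interpret BT: variable_order T b i B using T by (intro B.subinterval) auto
  have s1: "{a..T} \<subseteq> {a..b}" and s2: "{T..b} \<subseteq> {a..b}" using T by auto
  note c1 = continuous_on_subset[OF _ s1] and c2 = continuous_on_subset[OF _ s2]
  have lA: "continuous_on {a..T} (left_int i A a v)" and rB: "continuous_on {a..T} (right_int i B b v)"
    and rA: "continuous_on {a..T} (right_int i A T u)" and lB: "continuous_on {a..T} (left_int i B a u)"
    and lB2: "continuous_on {T..b} (left_int i B a u)" and lBT: "continuous_on {T..b} (left_int i B T u)"
    using c1[OF A.left_int_continuous[OF v]] c1[OF B.right_int_continuous[OF v]]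
      AT.right_int_continuous[OF c1[OF u]] c1[OF B.left_int_continuous[OF u]]
      c2[OF B.left_int_continuous[OF u]] BT.left_int_continuous[OF c2[OF u]] by blast+
  note cu = c1[OF u] and cv = c1[OF v] and cv2 = c2[OF v]
  have "integral {a..T} (\<lambda>t. u t * (p * left_int i A a v t + q * right_int i B b v t))
      = integral {a..T} (\<lambda>t. p * (u t * left_int i A a v t) + q * (u t * right_int i B b v t))"
    by (simp add: algebra_simps)
  also have "\<dots> = p * integral {a..T} (\<lambda>t. u t * left_int i A a v t)
      + q * integral {a..T} (\<lambda>t. u t * right_int i B b v t)"
    by (subst integral_add)
      (auto intro!: integrable_continuous_real continuous_on_mult cu lA rB)
  also have "integral {a..T} (\<lambda>t. u t * left_int i A a v t) = integral {a..T} (\<lambda>t. v t * right_int i A T u t)"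
    by (rule AT.left_int_swap[OF cu cv])
  also have "integral {a..T} (\<lambda>t. u t * right_int i B b v t) = integral {a..T} (\<lambda>t. v t * left_int i B a u t)
      + integral {T..b} (\<lambda>t. v t * (left_int i B a u t - left_int i B T u t))"
    using T by (intro B.right_int_swap u v) auto
  also have "p * integral {a..T} (\<lambda>t. v t * right_int i A T u t)
      + q * (integral {a..T} (\<lambda>t. v t * left_int i B a u t)
        + integral {T..b} (\<lambda>t. v t * (left_int i B a u t - left_int i B T u t)))
     = integral {a..T} (\<lambda>t. p * (v t * right_int i A T u t) + q * (v t * left_int i B a u t))
       + integral {T..b} (\<lambda>t. q * (v t * (left_int i B a u t - left_int i B T u t)))"
    by (subst integral_add)
      (auto intro!: integrable_continuous_real continuous_on_mult cv rA lB simp: distrib_left)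
  finally show ?thesis by (simp add: algebra_simps)
qed

section \<open>Euler-Lagrange equations and transversality conditions\<close>

theorem theorem49:
  fixes a b T xa :: real
    and n :: nat
    and \<alpha> \<beta> :: "nat \<Rightarrow> real \<times> real \<Rightarrow> real"
    and \<gamma> :: "nat \<Rightarrow> real \<times> real"
    and L :: "(nat \<Rightarrow> real) \<Rightarrow> real"
    and \<phi> :: "real \<Rightarrow> real \<Rightarrow> real"
    and xad :: "nat \<Rightarrow> real"
    and x :: "real \<Rightarrow> real"
    and dL :: "nat \<Rightarrow> real \<Rightarrow> real"
  assumes ab: "a < b" and n: "1 \<le> n"
    and \<alpha>_cont: "\<And>i. i \<in> {1..n} \<Longrightarrow> continuous_on ({a..b} \<times> {a..b}) (\<alpha> i)"
    and \<alpha>_range: "\<And>i. i \<in> {1..n} \<Longrightarrow> \<alpha> i ` ({a..b} \<times> {a..b}) \<subseteq> {real i - 1<..<real i}"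
    and \<beta>_cont: "\<And>i. i \<in> {1..n} \<Longrightarrow> continuous_on ({a..b} \<times> {a..b}) (\<beta> i)"
    and \<beta>_range: "\<And>i. i \<in> {1..n} \<Longrightarrow> \<beta> i ` ({a..b} \<times> {a..b}) \<subseteq> {real i - 1<..<real i}"
    and \<gamma>: "\<And>i. i \<in> {1..n} \<Longrightarrow> \<gamma> i \<in> {0..1} \<times> {0..1} \<and> \<gamma> i \<noteq> (0, 0)"
    and L: "C1_Lagrangian a b n L"
    and \<phi>: "C1_terminal a b \<phi>"
    and min: "minimizer a b n \<alpha> \<beta> \<gamma> L \<phi> xa xad x T"
    and T_free: "a < T" "T < b"
    and dL: "dL = partial_along a b n \<alpha> \<beta> \<gamma> L x"
    and ex_left: "\<And>i. i \<in> {1..n} \<Longrightarrow> snd (\<gamma> i) \<noteq> 0 \<Longrightarrow>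
          left_RL_exists i (\<beta> i) a b (dL (i+2)) \<and> left_RL_exists i (\<beta> i) T b (dL (i+2))"
    and ex_right: "\<And>i. i \<in> {1..n} \<Longrightarrow> fst (\<gamma> i) \<noteq> 0 \<Longrightarrow>
          right_RL_exists i (\<alpha> i) T a (dL (i+2))"
  shows
    "(\<forall>t\<in>{a..T}. dL 2 t + (\<Sum>i=1..n. dual_RL a b T i (\<alpha> i) (\<beta> i) (\<gamma> i) (dL (i+2)) t) = 0) \<and>
     (\<forall>t\<in>{T..b}. (\<Sum>i=1..n. snd (\<gamma> i) *
        (left_RL i (\<beta> i) a b (dL (i+2)) t - left_RL i (\<beta> i) T b (dL (i+2)) t)) = 0) \<and>
     (L (jet a b n \<alpha> \<beta> \<gamma> x T) + partial1 a b \<phi> T (x T) - nderiv {a..b} 1 x T *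
      (\<Sum>i=1..n.
         fst (\<gamma> i) * (-1) ^ (i-1) * nderiv {a..T} (i-1) (right_int i (\<alpha> i) T (dL (i+2))) T
         - snd (\<gamma> i) * nderiv {T..b} (i-1) (left_int i (\<beta> i) T (dL (i+2))) T) = 0) \<and>
     ((\<Sum>i=1..n.
         fst (\<gamma> i) * (-1) ^ (i-1) * nderiv {a..T} (i-1) (right_int i (\<alpha> i) T (dL (i+2))) T
         - snd (\<gamma> i) * nderiv {T..b} (i-1) (left_int i (\<beta> i) T (dL (i+2))) T)
      + partial2 \<phi> T (x T) = 0) \<and>
     (\<forall>j\<in>{2..n-1}. (\<Sum>i=j+1..n.
         fst (\<gamma> i) * (-1) ^ (i-1-j) * nderiv {a..T} (i-1-j) (right_int i (\<alpha> i) T (dL (i+2))) T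
         + snd (\<gamma> i) * (-1) ^ (j+1) * nderiv {T..b} (i-1-j) (left_int i (\<beta> i) T (dL (i+2))) T) = 0) \<and>
     (\<forall>j\<in>{0..n-1}. (\<Sum>i=j+1..n. snd (\<gamma> i) * (-1) ^ (j+1) *
         (nderiv {a..b} (i-1-j) (left_int i (\<beta> i) a (dL (i+2))) b
          - nderiv {T..b} (i-1-j) (left_int i (\<beta> i) T (dL (i+2))) b)) = 0)"
proof -
  let ?R = "\<lambda>i. right_int i (\<alpha> i) T (dL (i + 2))"
    and ?La = "\<lambda>i. left_int i (\<beta> i) a (dL (i + 2))" and ?LT = "\<lambda>i. left_int i (\<beta> i) T (dL (i + 2))"
  \<comment> \<open>The sign of the right Caputo derivative is stored in \<open>q i\<close>, to be
    cancelled by the sign (-1)^i that the reduction produces.\<close>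
  define q where "q i = snd (\<gamma> i) * (-1) ^ i" for i
  \<comment> \<open>\<open>Pm i\<close> and \<open>Pp i\<close> are the coefficients of the i-th
    derivative of the variation on \<open>{a..T}\<close> and on \<open>{T..b}\<close>.\<close>
  define Pm where "Pm i = (\<lambda>t. fst (\<gamma> i) * ?R i t + q i * ?La i t)" for i
  define Pp where "Pp i = (\<lambda>t. q i * ?La i t + (- q i) * ?LT i t)" for i
  have ord_\<alpha>: "variable_order a b i (\<alpha> i)" and ord_\<beta>: "variable_order a b i (\<beta> i)" if "i \<in> {1..n}" for i
    using that ab \<alpha>_cont \<alpha>_range \<beta>_cont \<beta>_range by (simp_all add: variable_order_def)
  have D: "(x, T) \<in> Dset a b n \<alpha> \<beta> \<gamma>"
    using min by (simp add: minimizer_def admissible_def)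
  have sub: "{a..T} \<subseteq> {a..b}" "{T..b} \<subseteq> {a..b}" using T_free by auto
  have dL_cont: "continuous_on {a..b} (dL k)" if "k \<in> {1..n+2}" for k
    unfolding dL partial_along_def[abs_def]
    by (rule continuous_on_compose2[OF C1_Lagrangian_partial_continuous[OF L that] jet_continuous[OF D]])
      (auto intro: jet_Ldom)
  have td_La: "times_differentiable_on i (?La i) {a..b}" and td_LT: "times_differentiable_on i (?LT i) {T..b}"
    if "i \<in> {1..n}" "q i \<noteq> 0" for i
    using ex_left[OF that(1)] that(2) by (auto simp: left_RL_exists_def q_def)
  have td_R: "times_differentiable_on i (?R i) {a..T}" if "i \<in> {1..n}" "fst (\<gamma> i) \<noteq> 0" for i
    using ex_right[OF that] by (simp add: right_RL_exists_def)
  have td_Pm: "times_differentiable_on i (Pm i) {a..T}" if i: "i \<in> {1..n}" for i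
    unfolding Pm_def
    by (rule times_differentiable_lincomb[OF T_free(1) td_R[OF i]
          times_differentiable_subinterval[OF td_La[OF i] sub(1) T_free(1)]])
  have td_Pp: "times_differentiable_on i (Pp i) {T..b}" if i: "i \<in> {1..n}" for i
    unfolding Pp_def
    by (rule times_differentiable_lincomb[OF T_free(2)
          times_differentiable_subinterval[OF td_La[OF i] sub(2) T_free(2)] td_LT[OF i]]) auto
  \<comment> \<open>The integral based at \<open>a\<close> is differentiated relative to
    \<open>{a..b}\<close> here and in \<open>nd_Pp\<close>, so both give the same derivatives of it
    at \<open>T\<close>.\<close>
  have nd_Pm: "nderiv {a..T} m (Pm i) t = fst (\<gamma> i) * nderiv {a..T} m (?R i) t + q i * nderiv {a..b} m (?La i) t"
    if "i \<in> {1..n}" "m \<le> i" "t \<in> {a..T}" for i m t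
  proof -
    have "nderiv {a..T} m (Pm i) t = fst (\<gamma> i) * nderiv {a..T} m (?R i) t + q i * nderiv {a..T} m (?La i) t"
      unfolding Pm_def
      by (rule nderiv_lincomb[OF T_free(1) td_R[OF that(1)]
            times_differentiable_subinterval[OF td_La[OF that(1)] sub(1) T_free(1)] that(2,3)])
    then show ?thesis
      using nderiv_subinterval[OF td_La[OF that(1)] sub(1) T_free(1) that(2,3)] by (cases "q i = 0") auto
  qed
  have nd_Pp: "nderiv {T..b} m (Pp i) t = q i * (nderiv {a..b} m (?La i) t - nderiv {T..b} m (?LT i) t)"
    if "i \<in> {1..n}" "m \<le> i" "t \<in> {T..b}" for i m t
  proof -
    have "nderiv {T..b} m (Pp i) t = q i * nderiv {T..b} m (?La i) t + (- q i) * nderiv {T..b} m (?LT i) t"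
      unfolding Pp_def
      by (rule nderiv_lincomb[OF T_free(2)
            times_differentiable_subinterval[OF td_La[OF that(1)] sub(2) T_free(2)] td_LT[OF that(1)] that(2,3)]) auto
    then show ?thesis
      using nderiv_subinterval[OF td_La[OF that(1)] sub(2) T_free(2) that(2,3)]
      by (cases "q i = 0") (auto simp: algebra_simps)
  qed
  have var: "integral {a..T} (\<lambda>t. dL 2 t * iterated_integral a g n t)
       + partial2 \<phi> T (x T) * iterated_integral a g n T
       + (\<Sum>i=1..n. integral {a..T} (\<lambda>t. Pm i t * iterated_integral a g (n - i) t)
          + integral {T..b} (\<lambda>t. Pp i t * iterated_integral a g (n - i) t)) = 0"
    if g: "continuous_on {a..b} g" for g
  proof -
    let ?h = "iterated_integral a g n"
    let ?C = "\<lambda>i. combined_Caputo a b i (\<alpha> i) (\<beta> i) (\<gamma> i) ?h"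
    have h: "?h \<in> C_on n {a..b}" by (rule iterated_integral_C_on[OF ab g])
    have nd_h: "nderiv {a..b} m ?h t = iterated_integral a g (n - m) t" if "m \<le> n" "t \<in> {a..b}" for m t
      by (rule nderiv_iterated_integral[OF ab g that])
    have Dh: "(?h, T) \<in> Dset a b n \<alpha> \<beta> \<gamma>"
      using T_free by (intro C_on_Dset ord_\<alpha> ord_\<beta> h) auto
    have "nderiv {a..b} m ?h a = 0" if "m < n" for m
      using nd_h[of m a] that ab by (cases "n - m") auto
    then have "integral {a..T} (\<lambda>t. \<Sum>k=2..n+2. dL k t * jet a b n \<alpha> \<beta> \<gamma> ?h t k)
        + partial2 \<phi> T (x T) * ?h T = 0"
      unfolding dL by (intro minimizer_first_variation[OF ab n ord_\<alpha> ord_\<beta> L \<phi> min h])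
    moreover have "(\<Sum>k=2..n+2. dL k t * jet a b n \<alpha> \<beta> \<gamma> ?h t k)
        = dL 2 t * ?h t + (\<Sum>i=1..n. dL (i+2) t * ?C i t)" for t
    proof -
      have "(\<Sum>k=2..n+2. dL k t * jet a b n \<alpha> \<beta> \<gamma> ?h t k)
          = dL 2 t * ?h t + (\<Sum>k=1+2..n+2. dL k t * jet a b n \<alpha> \<beta> \<gamma> ?h t k)"
        by (subst sum.atLeast_Suc_atMost) (auto simp: jet_def numeral_3_eq_3)
      also have "(\<Sum>k=1+2..n+2. dL k t * jet a b n \<alpha> \<beta> \<gamma> ?h t k) = (\<Sum>i=1..n. dL (i+2) t * ?C i t)"
        unfolding sum.shift_bounds_cl_nat_ivl by (intro sum.cong) (auto simp: jet_def)
      finally show ?thesis .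
    qed
    moreover have "integral {a..T} (\<lambda>t. dL 2 t * ?h t + (\<Sum>i=1..n. dL (i+2) t * ?C i t))
        = integral {a..T} (\<lambda>t. dL 2 t * ?h t) + (\<Sum>i=1..n. integral {a..T} (\<lambda>t. dL (i+2) t * ?C i t))"
    proof -
      have c: "continuous_on {a..T} (\<lambda>t. dL 2 t * ?h t)"
        using continuous_on_subset[OF dL_cont sub(1)]
          continuous_on_subset[OF iterated_integral_continuous[OF g] sub(1)]
        by (intro continuous_on_mult) auto
      have ci: "continuous_on {a..T} (\<lambda>t. dL (i+2) t * ?C i t)" if "i \<in> {1..n}" for i
      proof (rule continuous_on_mult)
        show "continuous_on {a..T} (dL (i+2))"
          using that by (intro continuous_on_subset[OF dL_cont sub(1)]) auto
        show "continuous_on {a..T} (?C i)"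
          using Dh that by (intro continuous_on_subset[OF _ sub(1)]) (auto simp: Dset_def)
      qed
      have "integral {a..T} (\<lambda>t. dL 2 t * ?h t + (\<Sum>i=1..n. dL (i+2) t * ?C i t))
        = integral {a..T} (\<lambda>t. dL 2 t * ?h t) + integral {a..T} (\<lambda>t. \<Sum>i=1..n. dL (i+2) t * ?C i t)"
        by (intro integral_add integrable_continuous_real c continuous_on_sum ci)
      also have "integral {a..T} (\<lambda>t. \<Sum>i=1..n. dL (i+2) t * ?C i t)
          = (\<Sum>i=1..n. integral {a..T} (\<lambda>t. dL (i+2) t * ?C i t))"
        by (intro integral_sum integrable_continuous_real ci) auto
      finally show ?thesis .
    qed
    moreover have "integral {a..T} (\<lambda>t. dL (i+2) t * ?C i t)
        = integral {a..T} (\<lambda>t. Pm i t * iterated_integral a g (n - i) t)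
          + integral {T..b} (\<lambda>t. Pp i t * iterated_integral a g (n - i) t)" if i: "i \<in> {1..n}" for i
    proof -
      let ?v = "nderiv {a..b} i ?h"
      have "integral {a..T} (\<lambda>t. dL (i+2) t * ?C i t)
          = integral {a..T} (\<lambda>t. dL (i+2) t *
              (fst (\<gamma> i) * left_int i (\<alpha> i) a ?v t + q i * right_int i (\<beta> i) b ?v t))"
        by (simp add: combined_Caputo_def left_Caputo_def right_Caputo_def q_def algebra_simps)
      also have "\<dots> = integral {a..T} (\<lambda>t. Pm i t * ?v t) + integral {T..b} (\<lambda>t. Pp i t * ?v t)"
        unfolding Pm_def Pp_def
        using T_free i by (intro combined_integration_by_parts[OF ord_\<alpha>[OF i] ord_\<beta>[OF i]]
            dL_cont C_on_nderiv_continuous[OF h]) auto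
      also have "integral {a..T} (\<lambda>t. Pm i t * ?v t)
          = integral {a..T} (\<lambda>t. Pm i t * iterated_integral a g (n - i) t)"
        using sub i by (intro integral_cong) (auto simp: nd_h subset_iff)
      also have "integral {T..b} (\<lambda>t. Pp i t * ?v t)
          = integral {T..b} (\<lambda>t. Pp i t * iterated_integral a g (n - i) t)"
        using sub i by (intro integral_cong) (auto simp: nd_h subset_iff)
      finally show ?thesis .
    qed
    ultimately show ?thesis by simp
  qed
  have dL2: "continuous_on {a..T} (dL 2)"
    by (rule continuous_on_subset[OF dL_cont sub(1)]) auto
  have left_eq: "dL 2 t + (\<Sum>i=1..n. (-1) ^ i * nderiv {a..T} i (Pm i) t) = 0" if "t \<in> {a..T}" for t
    by (rule variation_left[OF T_free n dL2 td_Pm td_Pp var that])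
  have right_eq: "(\<Sum>i=1..n. (-1) ^ i * nderiv {T..b} i (Pp i) t) = 0" if "t \<in> {T..b}" for t
    by (rule variation_right[OF T_free n dL2 td_Pm td_Pp var that])
  have end_eq: "(\<Sum>i=Suc j..n. (-1) ^ (i - j) * nderiv {T..b} (i - 1 - j) (Pp i) b) = 0" if "j < n" for j
    by (rule variation_end[OF T_free n dL2 td_Pm td_Pp var that])
  have jump_eq: "(\<Sum>i=Suc j..n. (-1) ^ (i - j) * nderiv {a..T} (i - 1 - j) (Pm i) T)
      = (\<Sum>i=Suc j..n. (-1) ^ (i - j) * nderiv {T..b} (i - 1 - j) (Pp i) T)
        + (if j = 0 then partial2 \<phi> T (x T) else 0)" if "j < n" for j
    by (rule variation_jump[OF T_free n dL2 td_Pm td_Pp var that])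
  \<comment> \<open>The second identity explains why the terms weighted by
    \<open>snd (\<gamma> i)\<close> carry a sign that depends on j and not on i.\<close>
  have sign: "(-1::real) ^ (i - j) = - ((-1) ^ (i - 1 - j))" "(-1::real) ^ (i - j) * (-1) ^ i = (-1) ^ j"
    if ij: "i \<in> {Suc j..n}" for i j
  proof -
    obtain d where "i = Suc j + d" using ij le_Suc_ex[of "Suc j" i] by auto
    then show "(-1::real) ^ (i - j) = - ((-1) ^ (i - 1 - j))" "(-1::real) ^ (i - j) * (-1) ^ i = (-1) ^ j"
      by (simp_all add: power_add)
  qed
  have EL1: "dL 2 t + (\<Sum>i=1..n. dual_RL a b T i (\<alpha> i) (\<beta> i) (\<gamma> i) (dL (i+2)) t) = 0" if t: "t \<in> {a..T}" for t
  proof -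
    \<comment> \<open>(-1)^i \<open>q i\<close> is the bare weight of the left derivative, while on
      the other summand (-1)^i is the sign of the right Riemann-Liouville derivative.\<close>
    have "(\<Sum>i=1..n. dual_RL a b T i (\<alpha> i) (\<beta> i) (\<gamma> i) (dL (i+2)) t)
        = (\<Sum>i=1..n. (-1) ^ i * nderiv {a..T} i (Pm i) t)"
      using t by (intro sum.cong refl, subst nd_Pm)
        (auto simp: dual_RL_def left_RL_def right_RL_def q_def algebra_simps)
    then show ?thesis using left_eq[OF t] by simp
  qed
  have EL2: "(\<Sum>i=1..n. snd (\<gamma> i) *
        (left_RL i (\<beta> i) a b (dL (i+2)) t - left_RL i (\<beta> i) T b (dL (i+2)) t)) = 0" if t: "t \<in> {T..b}" for t
  proof -
    have "(\<Sum>i=1..n. snd (\<gamma> i) * (left_RL i (\<beta> i) a b (dL (i+2)) t - left_RL i (\<beta> i) T b (dL (i+2)) t))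
        = (\<Sum>i=1..n. (-1) ^ i * nderiv {T..b} i (Pp i) t)"
      using t by (intro sum.cong refl, subst nd_Pp)
        (auto simp: left_RL_def q_def algebra_simps)
    then show ?thesis using right_eq[OF t] by simp
  qed
  \<comment> \<open>In the difference of \<open>Pm\<close> and \<open>Pp\<close> at \<open>T\<close>
    the contributions of the integral based at \<open>a\<close> cancel; only the two integrals based
    at \<open>T\<close> survive. The case j = 0 is the state condition.\<close>
  have jump: "(\<Sum>i=j+1..n.
         fst (\<gamma> i) * (-1) ^ (i-1-j) * nderiv {a..T} (i-1-j) (?R i) T
         + snd (\<gamma> i) * (-1) ^ (j+1) * nderiv {T..b} (i-1-j) (?LT i) T) = - (if j = 0 then partial2 \<phi> T (x T) else 0)"
    if j: "j < n" for j
  proof -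
    have "(\<Sum>i=j+1..n. fst (\<gamma> i) * (-1) ^ (i-1-j) * nderiv {a..T} (i-1-j) (?R i) T
         + snd (\<gamma> i) * (-1) ^ (j+1) * nderiv {T..b} (i-1-j) (?LT i) T)
       = (\<Sum>i=Suc j..n. - ((-1) ^ (i - j) * nderiv {a..T} (i - 1 - j) (Pm i) T
            - (-1) ^ (i - j) * nderiv {T..b} (i - 1 - j) (Pp i) T))"
    proof (rule sum.cong)
      fix i assume "i \<in> {Suc j..n}"
      note s = sign[OF this]
      have i: "i \<in> {1..n}" "i - 1 - j \<le> i" and T: "T \<in> {a..T}" "T \<in> {T..b}"
        using \<open>i \<in> {Suc j..n}\<close> T_free by auto
      have "- ((-1) ^ (i - j) * nderiv {a..T} (i - 1 - j) (Pm i) T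
            - (-1) ^ (i - j) * nderiv {T..b} (i - 1 - j) (Pp i) T)
          = - ((-1) ^ (i - j)) * fst (\<gamma> i) * nderiv {a..T} (i-1-j) (?R i) T
            - ((-1) ^ (i - j) * (-1) ^ i) * snd (\<gamma> i) * nderiv {T..b} (i-1-j) (?LT i) T"
        unfolding nd_Pm[OF i T(1)] nd_Pp[OF i T(2)] q_def by (simp add: algebra_simps)
      then show "fst (\<gamma> i) * (-1) ^ (i-1-j) * nderiv {a..T} (i-1-j) (?R i) T
         + snd (\<gamma> i) * (-1) ^ (j+1) * nderiv {T..b} (i-1-j) (?LT i) T
         = - ((-1) ^ (i - j) * nderiv {a..T} (i - 1 - j) (Pm i) T
            - (-1) ^ (i - j) * nderiv {T..b} (i - 1 - j) (Pp i) T)"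
        unfolding s(2) unfolding s(1) by (simp add: algebra_simps)
    qed simp
    then show ?thesis using jump_eq[OF j] by (simp add: sum_negf sum_subtractf)
  qed
  have end_b: "(\<Sum>i=j+1..n. snd (\<gamma> i) * (-1) ^ (j+1) *
         (nderiv {a..b} (i-1-j) (?La i) b - nderiv {T..b} (i-1-j) (?LT i) b)) = 0" if j: "j < n" for j
  proof -
    have "(\<Sum>i=j+1..n. snd (\<gamma> i) * (-1) ^ (j+1) *
         (nderiv {a..b} (i-1-j) (?La i) b - nderiv {T..b} (i-1-j) (?LT i) b))
       = (\<Sum>i=Suc j..n. - ((-1) ^ (i - j) * nderiv {T..b} (i - 1 - j) (Pp i) b))"
    proof (rule sum.cong)
      fix i assume "i \<in> {Suc j..n}"
      note s = sign(2)[OF this]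
      have i: "i \<in> {1..n}" "i - 1 - j \<le> i" and b: "b \<in> {T..b}"
        using \<open>i \<in> {Suc j..n}\<close> T_free by auto
      have "- ((-1) ^ (i - j) * nderiv {T..b} (i - 1 - j) (Pp i) b)
          = - ((-1) ^ (i - j) * (-1) ^ i) * snd (\<gamma> i) *
             (nderiv {a..b} (i-1-j) (?La i) b - nderiv {T..b} (i-1-j) (?LT i) b)"
        unfolding nd_Pp[OF i b] q_def by (simp add: algebra_simps)
      then show "snd (\<gamma> i) * (-1) ^ (j+1) *
         (nderiv {a..b} (i-1-j) (?La i) b - nderiv {T..b} (i-1-j) (?LT i) b)
         = - ((-1) ^ (i - j) * nderiv {T..b} (i - 1 - j) (Pp i) b)"
        unfolding s by simp
    qed simp
    then show ?thesis using end_eq[OF j] by (simp add: sum_negf)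
  qed
  have state: "(\<Sum>i=1..n.
         fst (\<gamma> i) * (-1) ^ (i-1) * nderiv {a..T} (i-1) (?R i) T
         - snd (\<gamma> i) * nderiv {T..b} (i-1) (?LT i) T) = - partial2 \<phi> T (x T)"
    using jump[of 0] n by simp
  have time: "L (jet a b n \<alpha> \<beta> \<gamma> x T)
      + (partial1 a b \<phi> T (x T) + partial2 \<phi> T (x T) * nderiv {a..b} 1 x T) = 0"
    by (rule minimizer_transversality_time[OF ab n ord_\<alpha> ord_\<beta> L \<phi> min T_free])
  \<comment> \<open>Rewriting by \<open>state\<close> replaces both sums over all orders by
    -\<open>partial2 \<phi> T (x T)\<close>. The time condition thereby becomes \<open>time\<close>,
    and the state condition an identity.\<close>
  show ?thesis
    unfolding state
  proof (intro conjI ballI)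
    show "L (jet a b n \<alpha> \<beta> \<gamma> x T) + partial1 a b \<phi> T (x T)
        - nderiv {a..b} 1 x T * - partial2 \<phi> T (x T) = 0"
      using time by (simp add: algebra_simps del: nderiv.simps)
    show "- partial2 \<phi> T (x T) + partial2 \<phi> T (x T) = 0" by simp
  qed (use EL1 EL2 jump end_b n in \<open>auto simp del: nderiv.simps\<close>)
qed

end
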